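(* There is an algorithm which, given integers $n,m>1$, decides whether the directed graph $G_{n,m,2}$ is Hamiltonian, and whose running time is $\mathcal{O}\big((m+n)\gcd(m,n)^3\big)$.
   Context: The graph $G_{n,m,2}$ (an augmented directed grid graph on a two-holed torus): its vertices are the $4nm$ cells $(i,c)$ of a grid with $2n$ rows $0\le i<2n$ (row $0$ on top) and $2m$ columns $0\le c<2m$ (column $0$ leftmost). The bijection $u$ ("up") on cells is $u(i,c)=(i-1,c)$ if $i\ge 1$, and $u(0,c)=(2n-1,(c+m)\bmod 2m)$. The bijection $r$ ("right") on cells is $r(i,c)=(i,c+1)$ if $c<2m-1$, and $r(i,2m-1)=((i+n)\bmod 2n,0)$. The directed edges are $(\alpha,u\alpha)$ and $(\alpha,r\alpha)$ for every cell $\alpha$. A directed graph is Hamiltonian if it has a directed cycle visiting every vertex exactly once. Running time is measured by the number of elementary arithmetic operations (addition, subtraction, multiplication, division with remainder, comparison) on integers. *)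

theory Defs
  imports "Graph_Theory.Digraph" "Graph_Theory.Arc_Walk"
begin

section \<open>The graph\<close>

type_synonym cell = "nat \<times> nat"

text \<open>Cells are pairs (row, column), with row 0 on top.\<close>

definition cells :: "nat \<Rightarrow> nat \<Rightarrow> cell set" where
  "cells n m = {0..<2*n} \<times> {0..<2*m}"

fun up :: "nat \<Rightarrow> nat \<Rightarrow> cell \<Rightarrow> cell" where
  "up n m (i, c) = (if i \<ge> 1 then (i - 1, c) else (2*n - 1, (c + m) mod (2*m)))"

fun right :: "nat \<Rightarrow> nat \<Rightarrow> cell \<Rightarrow> cell" where
  "right n m (i, c) = (if c < 2*m - 1 then (i, c + 1) else ((i + n) mod (2*n), 0))"

text \<open>For \<open>n, m > 1\<close> we have \<open>up n m \<alpha> \<noteq> right n m \<alpha>\<close> for every cell \<open>\<alpha>\<close>, so there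
  are no parallel arcs and arcs can be represented by pairs of cells.\<close>

definition torus_graph :: "nat \<Rightarrow> nat \<Rightarrow> (cell, cell \<times> cell) pre_digraph" where
  "torus_graph n m =
     \<lparr> verts = cells n m,
       arcs = {(\<alpha>, up n m \<alpha>) | \<alpha>. \<alpha> \<in> cells n m} \<union> {(\<alpha>, right n m \<alpha>) | \<alpha>. \<alpha> \<in> cells n m},
       tail = fst, head = snd \<rparr>"

text \<open>The library's cycles are nonempty and repeat no vertex apart from the common
  start and end vertex.\<close>

definition hamiltonian :: "('a, 'b) pre_digraph \<Rightarrow> bool" where
  "hamiltonian G \<longleftrightarrow>
     (\<exists>u p. pre_digraph.cycle G p \<and> pre_digraph.awalk G u p u \<and>
            set (pre_digraph.awalk_verts G u p) = verts G)"


section \<open>Algorithms and their running time\<close>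

text \<open>Algorithms are programs for a random access machine over the (unbounded) integers,
  with finitely many named registers occurring in a program and an indirectly addressed
  memory. As the syntax is a datatype, a program is a finite object, independent of its input.\<close>

type_synonym vname = string

datatype aexp =
    Const int
  | Reg vname
  | Load aexp
  | Add aexp aexp
  | Sub aexp aexp
  | Mul aexp aexp
  | Div aexp aexp
  | Mod aexp aexp

datatype bexp =
    Less aexp aexp
  | Eq aexp aexp
  | Not bexp
  | And bexp bexp
  | Or bexp bexp

datatype com =
    Skip
  | Assign vname aexp
  | Store aexp aexp  \<comment> \<open>address, value\<close>
  | Seq com com
  | If bexp com com
  | While bexp com

record state =
  reg :: "vname \<Rightarrow> int"
  mem :: "int \<Rightarrow> int"

text \<open>Division rounds towards minus infinity, and \<open>a div 0 = 0\<close>, \<open>a mod 0 = a\<close>.\<close>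

fun aval :: "aexp \<Rightarrow> state \<Rightarrow> int" where
  "aval (Const k) s = k"
| "aval (Reg x) s = reg s x"
| "aval (Load a) s = mem s (aval a s)"
| "aval (Add a b) s = aval a s + aval b s"
| "aval (Sub a b) s = aval a s - aval b s"
| "aval (Mul a b) s = aval a s * aval b s"
| "aval (Div a b) s = aval a s div aval b s"
| "aval (Mod a b) s = aval a s mod aval b s"

fun bval :: "bexp \<Rightarrow> state \<Rightarrow> bool" where
  "bval (Less a b) s \<longleftrightarrow> aval a s < aval b s"
| "bval (Eq a b) s \<longleftrightarrow> aval a s = aval b s"
| "bval (Not p) s \<longleftrightarrow> \<not> bval p s"
| "bval (And p q) s \<longleftrightarrow> bval p s \<and> bval q s"
| "bval (Or p q) s \<longleftrightarrow> bval p s \<or> bval q s"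

text \<open>The cost is the number of arithmetic operations and comparisons performed. Every guard
  contains a comparison, so each loop test costs at least 1. Between two guards only a bounded
  number (depending on the program alone) of register and memory accesses, assignments and
  Boolean connectives is executed, so charging for these as well would change the running time
  by at most a constant factor (and an additive constant).\<close>

fun acost :: "aexp \<Rightarrow> nat" where
  "acost (Const k) = 0"
| "acost (Reg x) = 0"
| "acost (Load a) = acost a"
| "acost (Add a b) = acost a + acost b + 1"
| "acost (Sub a b) = acost a + acost b + 1"
| "acost (Mul a b) = acost a + acost b + 1"
| "acost (Div a b) = acost a + acost b + 1"
| "acost (Mod a b) = acost a + acost b + 1"

fun bcost :: "bexp \<Rightarrow> nat" where
  "bcost (Less a b) = acost a + acost b + 1"
| "bcost (Eq a b) = acost a + acost b + 1"
| "bcost (Not p) = bcost p"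
| "bcost (And p q) = bcost p + bcost q"
| "bcost (Or p q) = bcost p + bcost q"

text \<open>\<open>exec c s t s'\<close>: started in state \<open>s\<close>, the program \<open>c\<close> halts in state \<open>s'\<close> after
  \<open>t\<close> elementary operations.\<close>

inductive exec :: "com \<Rightarrow> state \<Rightarrow> nat \<Rightarrow> state \<Rightarrow> bool" where
  Skip: "exec Skip s 0 s"
| Assign: "exec (Assign x a) s (acost a) (s\<lparr>reg := (reg s)(x := aval a s)\<rparr>)"
| Store: "exec (Store a b) s (acost a + acost b) (s\<lparr>mem := (mem s)(aval a s := aval b s)\<rparr>)"
| Seq: "exec c1 s1 t1 s2 \<Longrightarrow> exec c2 s2 t2 s3 \<Longrightarrow> exec (Seq c1 c2) s1 (t1 + t2) s3"
| IfTrue: "bval b s \<Longrightarrow> exec c1 s t s' \<Longrightarrow> exec (If b c1 c2) s (bcost b + t) s'"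
| IfFalse: "\<not> bval b s \<Longrightarrow> exec c2 s t s' \<Longrightarrow> exec (If b c1 c2) s (bcost b + t) s'"
| WhileFalse: "\<not> bval b s \<Longrightarrow> exec (While b c) s (bcost b) s"
| WhileTrue: "bval b s1 \<Longrightarrow> exec c s1 t1 s2 \<Longrightarrow> exec (While b c) s2 t2 s3 \<Longrightarrow>
    exec (While b c) s1 (bcost b + t1 + t2) s3"

inductive_cases exec_SkipE: "exec Skip s t s'"
inductive_cases exec_AssignE: "exec (Assign x a) s t s'"
inductive_cases exec_StoreE: "exec (Store a b) s t s'"
inductive_cases exec_SeqE: "exec (Seq c1 c2) s t s'"
inductive_cases exec_IfE: "exec (If b c1 c2) s t s'"
inductive_cases exec_WhileE: "exec (While b c) s t s'"

lemma exec_deterministic: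
  "exec c s t s' \<Longrightarrow> exec c s u s'' \<Longrightarrow> t = u \<and> s' = s''"
proof (induction arbitrary: u s'' rule: exec.induct)
  case (Skip s)
  from Skip.prems show ?case by (rule exec_SkipE) simp
next
  case (Assign x a s)
  from Assign.prems show ?case by (rule exec_AssignE) simp
next
  case (Store a b s)
  from Store.prems show ?case by (rule exec_StoreE) simp
next
  case (Seq c1 s1 t1 s2 c2 t2 s3)
  from Seq.prems obtain v1 r v2 where
    v: "exec c1 s1 v1 r" "exec c2 r v2 s''" "u = v1 + v2"
    by (rule exec_SeqE)
  from Seq.IH(1)[OF v(1)] Seq.IH(2) v(2,3) show ?case by simp
next
  case (IfTrue b s c1 t s' c2)
  from IfTrue.prems show ?case
    by (rule exec_IfE) (use IfTrue.IH IfTrue.hyps(1) in simp_all)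
next
  case (IfFalse b s c2 t s' c1)
  from IfFalse.prems show ?case
    by (rule exec_IfE) (use IfFalse.IH IfFalse.hyps(1) in simp_all)
next
  case (WhileFalse b s c)
  from WhileFalse.prems show ?case
    by (rule exec_WhileE) (use WhileFalse.hyps in simp_all)
next
  case (WhileTrue b s1 c t1 s2 t2 s3)
  from WhileTrue.prems obtain v1 r v2 where
    v: "exec c s1 v1 r" "exec (While b c) r v2 s''" "u = bcost b + v1 + v2"
    by (rule exec_WhileE) (use WhileTrue.hyps(1) in simp_all)
  from WhileTrue.IH(1)[OF v(1)] WhileTrue.IH(2) v(2,3) show ?case by simp
qed

text \<open>The inputs are passed in two registers; everything else is initially 0.\<close>

definition input_state :: "nat \<Rightarrow> nat \<Rightarrow> state" where
  "input_state n m = \<lparr> reg = (\<lambda>_. 0)(''n'' := int n, ''m'' := int m), mem = (\<lambda>_. 0) \<rparr>"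

definition decides_within :: "com \<Rightarrow> nat \<Rightarrow> nat \<Rightarrow> bool \<Rightarrow> nat \<Rightarrow> bool" where
  "decides_within c n m P T \<longleftrightarrow>
     (\<exists>t s. exec c (input_state n m) t s \<and> reg s ''result'' = (if P then 1 else 0) \<and> t \<le> T)"

end

theory Submission
  imports Defs "HOL-Library.FuncSet" "HOL-Number_Theory.Cong"
begin

text \<open>A Hamiltonian cycle makes a choice between up and right at each cell, and \<open>up \<alpha> = right \<beta>\<close> forces
  the same choice at \<open>\<alpha>\<close> and \<open>\<beta>\<close>. So the choice is constant on the orbits of \<open>right\<inverse> \<circ> up\<close>, which run along
  diagonals and amount to the orbits of an order-reversing exchange \<open>T\<close> of four intervals of lengths
  \<open>m, m, n, n\<close>. There are at most \<open>6 gcd m n\<close> orbits. Translation by \<open>-1\<close> arranges them in at most three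
  chains that end at the singularity, and since up and right commute elsewhere, adjacent orbits of a
  chain may exchange their choices. So only the number of orbits with choice up in each chain
  matters, which leaves \<open>O((gcd m n)\<^sup>3)\<close> cases.

  For a fixed choice the walk crosses the square along disjoint lines. Leaving the square and
  re-entering it, it permutes these lines again by an order-reversing exchange of four intervals,
  whose lengths count the diagonals of either choice on the four half-sides. Its cycle through 0 is
  traversed in \<open>O(m + n)\<close> steps.\<close>

section \<open>Iterated permutations\<close>

text \<open>The points \<open>0\<close>, \<open>M\<close>, \<open>N\<close> do two jobs at once.
  Every cell where up and right fail to commute lies on one of these diagonals; and together with
  \<open>2 * M\<close> (preimage of \<open>N\<close>) and \<open>2 * M + N\<close> (preimage of
  \<open>0\<close>) they cover the left endpoints of the intervals of \<open>T\<close>, where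
  translation by -1 breaks. So the single condition \<open>good\<close> on an orbit makes its
  translate an orbit and makes the exchange of choices harmless. The factor 6 is 3 * 2: a countdown
  along an orbit, stated modulo \<open>m + n\<close>, cannot skip three consecutive values, and the
  domain of \<open>T\<close> contains two periods. Chains may share orbits, so an orbit needs one
  canonical label telling which number decides about it. Labels are computed once, in
  \<open>O((m + n) gcd m n)\<close> operations; after that a case costs one counting pass for the
  four interval lengths and one traversal of the cycle through 0, both linear in
  \<open>m + n\<close>.\<close>

definition orb :: "('a \<Rightarrow> 'a) \<Rightarrow> 'a \<Rightarrow> 'a set" where
  "orb f x = range (\<lambda>k. (f ^^ k) x)"

lemma funpow_add_apply: "(f ^^ (i + j)) x = (f ^^ i) ((f ^^ j) x)"
  by (simp add: funpow_add)

lemma funpow_mem: "f \<in> A \<rightarrow> A \<Longrightarrow> x \<in> A \<Longrightarrow> (f ^^ k) x \<in> A"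
  by (induction k) auto

lemma inj_on_funpow: "inj_on f A \<Longrightarrow> f \<in> A \<rightarrow> A \<Longrightarrow> inj_on (f ^^ k) A"
proof (induction k)
  case (Suc k)
  then have "inj_on (f ^^ k) A" "inj_on f ((f ^^ k) ` A)"
    by (auto intro: inj_on_subset[of f A] funpow_mem)
  then show ?case by (metis comp_inj_on funpow.simps(2))
qed simp

lemma orb_self: "x \<in> orb f x"
  unfolding orb_def by (rule image_eqI[of _ _ 0]) auto

lemma orb_funpow: "(f ^^ k) x \<in> orb f x"
  by (simp add: orb_def)

lemma orb_step: "y \<in> orb f x \<Longrightarrow> f y \<in> orb f x"
proof -
  assume "y \<in> orb f x"
  then obtain k where "y = (f ^^ k) x" by (auto simp: orb_def)
  then have "f y = (f ^^ Suc k) x" by simp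
  then show ?thesis by (metis orb_funpow)
qed

lemma orb_trans: "y \<in> orb f x \<Longrightarrow> z \<in> orb f y \<Longrightarrow> z \<in> orb f x"
proof -
  assume "y \<in> orb f x" "z \<in> orb f y"
  then obtain j k where "y = (f ^^ j) x" "z = (f ^^ k) y" by (auto simp: orb_def)
  then have "z = (f ^^ (k + j)) x" by (simp add: funpow_add)
  then show ?thesis by (metis orb_funpow)
qed

lemma orb_subset: "f \<in> A \<rightarrow> A \<Longrightarrow> x \<in> A \<Longrightarrow> orb f x \<subseteq> A"
  unfolding orb_def by (auto simp: funpow_mem)

locale finite_perm =
  fixes f :: "'a \<Rightarrow> 'a" and A :: "'a set"
  assumes fin: "finite A" and inj: "inj_on f A" and maps: "f \<in> A \<rightarrow> A"
begin

lemma image_eq: "f ` A = A"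
  using endo_inj_surj[OF fin _ inj] maps by auto

lemma funpow_return:
  assumes "x \<in> A"
  obtains k where "k > 0" "k \<le> card A" "(f ^^ k) x = x"
proof -
  have "\<not> inj_on (\<lambda>j. (f ^^ j) x) {0..card A}"
    using card_inj_on_le[of "\<lambda>j. (f ^^ j) x" "{0..card A}" A] fin funpow_mem[OF maps assms] by auto
  then obtain i j where ij: "i \<le> card A" "j \<le> card A" "i < j" "(f ^^ i) x = (f ^^ j) x"
    unfolding inj_on_def by (metis atLeastAtMost_iff linorder_neqE_nat)
  have "(f ^^ i) ((f ^^ (j - i)) x) = (f ^^ j) x"
    using ij by (simp flip: funpow_add_apply)
  then have "(f ^^ (j - i)) x = x"
    using inj_on_funpow[OF inj maps, of i] ij funpow_mem[OF maps assms] assms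
    by (metis inj_onD)
  then show ?thesis using ij by (intro that[of "j - i"]) auto
qed

lemma funpow_mult_return: "(f ^^ k) x = x \<Longrightarrow> (f ^^ (k * j)) x = x"
  by (induction j) (auto simp: funpow_add)

lemma funpow_mod: "(f ^^ p) x = x \<Longrightarrow> (f ^^ k) x = (f ^^ (k mod p)) x"
  by (metis funpow_mult_return funpow_add_apply mod_mult_div_eq)

lemma orb_sym:
  assumes "x \<in> A" "y \<in> orb f x" shows "x \<in> orb f y"
proof -
  obtain p where p: "p > 0" "(f ^^ p) x = x" using funpow_return assms by metis
  obtain k where k: "y = (f ^^ k) x" using assms by (auto simp: orb_def)
  have "(f ^^ (p * k - k)) y = (f ^^ (p * k - k + k)) x"
    using k by (simp add: funpow_add)
  also have "\<dots> = x" using p by (simp add: funpow_mult_return)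
  finally show ?thesis by (metis orb_funpow)
qed

lemma orb_eq:
  assumes "x \<in> A" "y \<in> orb f x" shows "orb f y = orb f x"
  using orb_trans[OF assms(2)] orb_trans[OF orb_sym[OF assms]] by blast

text \<open>Some return time is at most \<open>card A\<close>, so reduction of exponents modulo it
  suffices. This lets a loop of fixed length mark a whole orbit.\<close>

lemma orb_bounded:
  assumes "x \<in> A" "card A \<le> c" shows "orb f x = (\<lambda>k. (f ^^ k) x) ` {..<c}"
proof -
  obtain p where p: "p > 0" "p \<le> card A" "(f ^^ p) x = x" using funpow_return assms by metis
  have "(f ^^ k) x \<in> (\<lambda>k. (f ^^ k) x) ` {..<c}" for k
    using p assms(2) mod_less_divisor[of p k] funpow_mod[OF p(3), of k]
    by (metis (no_types, lifting) imageI lessThan_iff less_le_trans order.strict_trans2)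
  then show ?thesis by (auto simp: orb_def)
qed

text \<open>Turns transitivity into the absence of an early return: one current point and one flag
  suffice to test it, without recording visited points.\<close>

lemma orb_eq_all_iff:
  assumes "x \<in> A"
  shows "orb f x = A \<longleftrightarrow> (\<forall>k. 0 < k \<longrightarrow> k < card A \<longrightarrow> (f ^^ k) x \<noteq> x)"
proof
  assume o: "orb f x = A"
  show "\<forall>k. 0 < k \<longrightarrow> k < card A \<longrightarrow> (f ^^ k) x \<noteq> x"
  proof (intro allI impI notI)
    fix k assume k: "0 < k" "k < card A" "(f ^^ k) x = x"
    have "A \<subseteq> (\<lambda>k. (f ^^ k) x) ` {..<k}"
    proof
      fix y assume "y \<in> A"
      then obtain j where "y = (f ^^ j) x" using o by (auto simp: orb_def)
      then have "y = (f ^^ (j mod k)) x" using funpow_mod[OF k(3)] by metis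
      then show "y \<in> (\<lambda>k. (f ^^ k) x) ` {..<k}" using k(1) by auto
    qed
    from card_mono[OF _ this] card_image_le[of "{..<k}" "\<lambda>k. (f ^^ k) x"] k show False by auto
  qed
next
  assume no: "\<forall>k. 0 < k \<longrightarrow> k < card A \<longrightarrow> (f ^^ k) x \<noteq> x"
  have "inj_on (\<lambda>k. (f ^^ k) x) {..<card A}"
  proof (rule linorder_inj_onI)
    fix i j assume ij: "i < j" "i \<in> {..<card A}" "j \<in> {..<card A}"
    show "(f ^^ i) x \<noteq> (f ^^ j) x"
    proof
      assume e: "(f ^^ i) x = (f ^^ j) x"
      have "(f ^^ i) ((f ^^ (j - i)) x) = (f ^^ j) x"
        using ij by (simp flip: funpow_add_apply)
      then have "(f ^^ (j - i)) x = x"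
        using inj_on_funpow[OF inj maps, of i] e funpow_mem[OF maps assms] assms
        by (metis inj_onD)
      then show False using no ij by auto
    qed
  qed auto
  then have "card ((\<lambda>k. (f ^^ k) x) ` {..<card A}) = card A" by (simp add: card_image)
  moreover have "(\<lambda>k. (f ^^ k) x) ` {..<card A} \<subseteq> A" using funpow_mem[OF maps assms] by auto
  ultimately have "(\<lambda>k. (f ^^ k) x) ` {..<card A} = A" using fin by (simp add: card_subset_eq)
  then show "orb f x = A" using orb_bounded[OF assms order_refl] by simp
qed

end

definition single_cycle :: "('a \<Rightarrow> 'a) \<Rightarrow> 'a set \<Rightarrow> bool" where
  "single_cycle f A \<longleftrightarrow> (\<forall>x\<in>A. A \<subseteq> orb f x)"


section \<open>Interval exchanges\<close>

definition iet :: "int \<Rightarrow> int \<Rightarrow> int \<Rightarrow> int \<Rightarrow> int \<Rightarrow> int" where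
  "iet w x y z p =
     (if p < w then p + x + y + z
      else if p < w + x then p + y + z - w
      else if p < w + x + y then p + z - w - x
      else p - w - x - y)"

lemma iet_perm:
  assumes "0 \<le> w" "0 \<le> x" "0 \<le> y" "0 \<le> z"
  shows "finite_perm (iet w x y z) {0..<w + x + y + z}"
  by unfold_locales (use assms in \<open>auto simp: inj_on_def iet_def split: if_splits\<close>)

section \<open>Diagonals of the torus\<close>

locale torus =
  fixes n m :: nat
  assumes n_gt: "n > 1" and m_gt: "m > 1"
begin

abbreviation N :: int where "N \<equiv> int n"
abbreviation M :: int where "M \<equiv> int m"
abbreviation I :: "int set" where "I \<equiv> {0..<2*M + 2*N}"

definition T :: "int \<Rightarrow> int" where "T = iet M M N N"

definition invariant :: "int set \<Rightarrow> bool" where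
  "invariant S \<longleftrightarrow> S \<subseteq> I \<and> (\<forall>x\<in>I. T x \<in> S \<longleftrightarrow> x \<in> S)"

lemma N_gt: "N > 1" and M_gt: "M > 1"
  using n_gt m_gt by auto

sublocale T: finite_perm T I
  using iet_perm[of M M N N] by (simp add: T_def algebra_simps)

lemma T_I: "x \<in> I \<Longrightarrow> T x \<in> I"
  using T.maps by (rule Pi_mem)

lemma orb_I: "x \<in> I \<Longrightarrow> y \<in> orb T x \<Longrightarrow> y \<in> I"
  using orb_subset[OF T.maps] by blast

lemma T_2M: "T (2 * M) = N" and T_2M_N: "T (2 * M + N) = 0"
  using N_gt M_gt by (auto simp: T_def iet_def)

text \<open>The excluded points are the left endpoints of the four intervals; elsewhere
  \<open>x - 1\<close> lies in the interval of \<open>x\<close> and is translated alike.\<close>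

lemma T_pred:
  assumes "x \<in> I" "x \<notin> {0, M, 2 * M, 2 * M + N}"
  shows "T (x - 1) = T x - 1"
  using assms N_gt M_gt by (auto simp: T_def iet_def)

section \<open>Invariant sets, and orbits under translation by -1\<close>

lemma invariant_orb:
  assumes "invariant S" "x \<in> I" "y \<in> orb T x"
  shows "y \<in> S \<longleftrightarrow> x \<in> S"
proof -
  have "(T ^^ k) x \<in> S \<longleftrightarrow> x \<in> S" for k
    using assms funpow_mem[OF T.maps assms(2)] by (induction k) (auto simp: invariant_def)
  then show ?thesis using assms(3) by (auto simp: orb_def)
qed

lemma invariant_orb_I: "x \<in> I \<Longrightarrow> invariant (orb T x)"
proof -
  assume x: "x \<in> I"
  have "y \<in> orb T x" if y: "y \<in> I" "T y \<in> orb T x" for y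
    using orb_trans[OF y(2) T.orb_sym[OF y(1) orb_step[OF orb_self]]] .
  then show ?thesis using orb_step orb_subset[OF T.maps x] by (auto simp: invariant_def)
qed

text \<open>Three forbidden points cover four left endpoints: \<open>2 * M\<close> and
  \<open>2 * M + N\<close> are sent by \<open>T\<close> to \<open>N\<close> and \<open>0\<close>, so
  an orbit avoiding the latter avoids the former too.\<close>

definition good :: "int \<Rightarrow> bool" where
  "good x \<longleftrightarrow> orb T x \<inter> {0, M, N} = {}"

lemma good_avoids:
  assumes "x \<in> I" "good x" "y \<in> orb T x"
  shows "y \<notin> {0, M, 2 * M, 2 * M + N}" "y \<notin> {0, M, N}"
  using assms orb_step[of y T x] T_2M T_2M_N by (auto simp: good_def)

lemma orb_pred:
  assumes "x \<in> I" "good x"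
  shows "orb T (x - 1) = (\<lambda>y. y - 1) ` orb T x"
proof -
  have "(T ^^ k) (x - 1) = (T ^^ k) x - 1" for k
  proof (induction k)
    case (Suc k)
    have "(T ^^ k) x \<in> orb T x" by (rule orb_funpow)
    with Suc T_pred good_avoids(1)[OF assms] orb_I[OF assms(1)] show ?case by simp
  qed simp
  then show ?thesis unfolding orb_def by auto
qed

lemma pred_I: "x \<in> I \<Longrightarrow> good x \<Longrightarrow> x - 1 \<in> I"
  using good_avoids(1)[of x x] orb_self[of x T] by auto

text \<open>The residue modulo \<open>gcd m n\<close> is preserved by \<open>T\<close>, and modulo \<open>m + n\<close> the map \<open>T\<close> adds \<open>n\<close>
  or \<open>3 n\<close>. So an orbit cannot jump over three consecutive multiples of \<open>n\<close>.\<close>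

lemma T_mod:
  assumes "x \<in> I"
  shows "(M + N) dvd (T x - x - N) \<or> (M + N) dvd (T x - x - 3 * N)"
    "T x mod int (gcd m n) = x mod int (gcd m n)"
proof -
  have "\<exists>j. T x - x - N = j * (M + N) \<or> T x - x - 3 * N = j * (M + N)"
  proof -
    consider "x < M" | "M \<le> x" "x < 2*M" | "2*M \<le> x" "x < 2*M+N" | "2*M+N \<le> x" by linarith
    then show ?thesis
    proof cases
      case 1 then show ?thesis by (intro exI[of _ 1]) (auto simp: T_def iet_def)
    next
      case 2 then show ?thesis by (intro exI[of _ "-1"]) (auto simp: T_def iet_def)
    next
      case 3 then show ?thesis using M_gt by (intro exI[of _ "-2"]) (auto simp: T_def iet_def)
    next
      case 4 then show ?thesis using M_gt N_gt by (intro exI[of _ "-2"]) (auto simp: T_def iet_def)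
    qed
  qed
  then show "(M + N) dvd (T x - x - N) \<or> (M + N) dvd (T x - x - 3 * N)"
    by (metis dvd_triv_right)
  have "int (gcd m n) dvd M" "int (gcd m n) dvd N" by auto
  then have "int (gcd m n) dvd T x - x" by (auto simp: T_def iet_def intro!: dvd_add dvd_diff)
  then show "T x mod int (gcd m n) = x mod int (gcd m n)"
    by (simp add: mod_eq_dvd_iff)
qed

definition transversal :: "int set" where
  "transversal = {x \<in> I. \<exists>k<3. (M + N) dvd (x + int k * N - x mod int (gcd m n))}"

text \<open>An element is recovered from its residue modulo \<open>gcd m n\<close>, the value
  \<open>k < 3\<close>, and the copy of the period \<open>M + N\<close> that contains it. The domain
  has length \<open>2 * (M + N)\<close>, so there are two copies and \<open>gcd m n * 3 * 2\<close>
  possibilities.\<close>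

lemma card_transversal: "finite transversal" "card transversal \<le> 6 * gcd m n"
proof -
  let ?g = "gcd m n"
  let ?A = "{0..<?g} \<times> {0..<3::nat} \<times> {0..<2::nat}"
  let ?h = "\<lambda>(r, k, l). (int r - int k * N) mod (M + N) + int l * (M + N)"
  have sub: "transversal \<subseteq> ?h ` ?A"
  proof
    fix x assume "x \<in> transversal"
    then obtain k where x: "x \<in> I" "k < 3" and d: "(M + N) dvd (x + int k * N - x mod int ?g)"
      by (auto simp: transversal_def)
    let ?r = "nat (x mod int ?g)" and ?l = "nat (x div (M + N))"
    have g: "int ?g > 0" using m_gt by simp
    have r: "int ?r = x mod int ?g" "?r < ?g" 
      using g by (auto simp: nat_less_iff)
    have "x div (M + N) \<ge> 0" using x M_gt N_gt by (auto simp: pos_imp_zdiv_nonneg_iff)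
    moreover have "x div (M + N) < 2"
    proof -
      have "x div (M + N) * (M + N) \<le> x" using mult_div_mod_eq[of "M + N" x]
          pos_mod_sign[of "M + N" x] M_gt N_gt by (smt (verit) mult.commute)
      also have "\<dots> < 2 * (M + N)" using x by auto
      finally show ?thesis using M_gt N_gt by (subst (asm) mult_less_cancel_right) auto
    qed
    ultimately have l: "int ?l = x div (M + N)" "?l < 2" by auto
    have "x mod (M + N) = (int ?r - int k * N) mod (M + N)"
      unfolding r mod_eq_dvd_iff using d by (simp add: algebra_simps)
    then have "x = ?h (?r, k, ?l)" using l(1) mult_div_mod_eq[of "M + N" x] by (simp add: algebra_simps)
    then show "x \<in> ?h ` ?A" using r(2) l(2) x(2) by (intro image_eqI[of _ _ "(?r, k, ?l)"]) auto
  qed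
  show "finite transversal" using sub by (rule finite_subset) auto
  have "card transversal \<le> card (?h ` ?A)" using sub by (intro card_mono) auto
  also have "\<dots> \<le> card ?A" by (rule card_image_le) auto
  also have "\<dots> = 6 * ?g" by simp
  finally show "card transversal \<le> 6 * ?g" .
qed

lemma transversal_hits:
  assumes "x \<in> I" shows "orb T x \<inter> transversal \<noteq> {}"
proof -
  let ?g = "int (gcd m n)"
  \<comment> \<open>\<open>k\<close> is a countdown: a step of \<open>T\<close> lowers it by 1 or by
    3, so from \<open>k \<ge> 3\<close> it stays nonnegative and must enter
    \<open>{0, 1, 2}\<close>.\<close>
  have hit: "x \<in> I \<Longrightarrow> (M + N) dvd (x + int k * N - x mod ?g) \<Longrightarrow> orb T x \<inter> transversal \<noteq> {}" for k x
  proof (induction k arbitrary: x rule: less_induct)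
    case (less k)
    show ?case
    proof (cases "k < 3")
      case True
      then show ?thesis using less.prems orb_self[of x T] by (auto simp: transversal_def)
    next
      case False
      obtain j where j: "j = 1 \<or> j = 3" "(M + N) dvd (T x - x - int j * N)"
        using T_mod(1)[OF less.prems(1)] by (metis mult_1 of_nat_1 of_nat_numeral)
      have e: "(T x + int (k - j) * N - T x mod ?g) = (T x - x - int j * N) + (x + int k * N - x mod ?g)"
        using False j T_mod(2)[OF less.prems(1)] by (auto simp: of_nat_diff algebra_simps)
      then have "(M + N) dvd (T x + int (k - j) * N - T x mod ?g)"
        by (subst e) (intro dvd_add j(2) less.prems(2))
      then have "orb T (T x) \<inter> transversal \<noteq> {}"
        using less.IH[of "k - j" "T x"] T_I[OF less.prems(1)] False j by auto
      moreover have "orb T (T x) \<subseteq> orb T x" by (auto intro: orb_trans[OF orb_step[OF orb_self]])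
      ultimately show ?thesis by blast
    qed
  qed
  \<comment> \<open>An initial value of the countdown solves a linear congruence modulo
    \<open>M + N\<close>. It is solvable because the right-hand side is divisible by
    \<open>gcd N (M + N)\<close>.\<close>
  have "gcd N (M + N) = ?g" by (metis add.commute gcd.commute gcd_add2 gcd_int_int_eq)
  moreover have "?g dvd (x mod ?g - x)" by (simp add: mod_eq_dvd_iff[symmetric])
  ultimately obtain y where y: "[N * y = x mod ?g - x] (mod (M + N))"
    using cong_solve_int[of N "M + N"] by (metis cong_scalar_right dvdE mult.assoc)
  let ?k = "y mod (M + N)"
  have "[N * ?k = x mod ?g - x] (mod (M + N))"
    using y by (metis cong_def mod_mult_right_eq)
  then have "(M + N) dvd (x + int (nat ?k) * N - x mod ?g)"
    using M_gt N_gt by (simp add: cong_iff_dvd_diff algebra_simps)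
  then show ?thesis using hit assms by blast
qed

section \<open>Distance of an orbit from the singularity\<close>

definition depth :: "int \<Rightarrow> nat" where
  "depth x = (LEAST h. \<exists>b\<in>{0, M, N}. b + int h \<in> orb T x)"

lemma depth_witness:
  assumes "x \<in> I"
  obtains b where "b \<in> {0, M, N}" "b + int (depth x) \<in> orb T x"
proof -
  have "\<exists>b\<in>{0, M, N}. b + int (nat x) \<in> orb T x"
    using assms orb_self[of x T] by auto
  then have "\<exists>b\<in>{0, M, N}. b + int (depth x) \<in> orb T x" unfolding depth_def by (rule LeastI)
  then show ?thesis using that by blast
qed

lemma depth_le: "b \<in> {0, M, N} \<Longrightarrow> b + int h \<in> orb T x \<Longrightarrow> depth x \<le> h"
  unfolding depth_def by (rule Least_le) blast

lemma depth_orb: "x \<in> I \<Longrightarrow> y \<in> orb T x \<Longrightarrow> depth y = depth x"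
  by (simp add: depth_def T.orb_eq)

lemma depth_pos_good: "depth x > 0 \<Longrightarrow> good x"
  using depth_le[of _ 0 x] by (fastforce simp: good_def)

text \<open>Positive depth means that the orbit is good, so the orbit of \<open>x - 1\<close> is the
  whole orbit of \<open>x\<close> moved down by one, and every distance to \<open>0\<close>,
  \<open>M\<close> or \<open>N\<close> drops by one.\<close>

lemma depth_pred:
  assumes "x \<in> I" "depth x = Suc h" shows "depth (x - 1) = h"
proof (rule antisym)
  have good: "good x" using assms depth_pos_good by auto
  note op = orb_pred[OF assms(1) good]
  obtain b where b: "b \<in> {0, M, N}" "b + int (Suc h) \<in> orb T x"
    using depth_witness[OF assms(1)] assms(2) by metis
  then have "b + int h \<in> orb T (x - 1)" unfolding op by (intro image_eqI[of _ _ "b + int (Suc h)"]) auto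
  then show "depth (x - 1) \<le> h" using depth_le b(1) by blast
  obtain b where b: "b \<in> {0, M, N}" "b + int (depth (x - 1)) \<in> orb T (x - 1)"
    using depth_witness[OF pred_I[OF assms(1) good]] by metis
  then have "b + int (Suc (depth (x - 1))) \<in> orb T x" unfolding op by (auto simp: algebra_simps)
  then show "h \<le> depth (x - 1)" using depth_le[OF b(1)] assms(2) by fastforce
qed

lemma depth_diff:
  assumes "x \<in> I" "t \<le> depth x" shows "x - int t \<in> I \<and> depth (x - int t) = depth x - t"
  using assms(2)
proof (induction t)
  case (Suc t)
  then have *: "x - int t \<in> I" "depth (x - int t) = Suc (depth x - Suc t)" by auto
  then have "good (x - int t)" by (intro depth_pos_good) auto
  with pred_I[OF *(1)] depth_pred[OF *] show ?case by (simp add: algebra_simps)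
qed (use assms in auto)

text \<open>Depths have no gaps: moving down from \<open>x\<close> realises every depth from
  \<open>depth x\<close> to 0. These are \<open>depth x + 1\<close> different orbits, each owning a
  point of \<open>transversal\<close>.\<close>

lemma depth_less:
  assumes "x \<in> I" shows "depth x < 6 * gcd m n"
proof -
  have "\<forall>t\<in>{..depth x}. \<exists>y\<in>transversal. depth y = depth x - t"
  proof
    fix t assume "t \<in> {..depth x}"
    then have t: "x - int t \<in> I" "depth (x - int t) = depth x - t" using depth_diff assms by auto
    obtain y where "y \<in> orb T (x - int t)" "y \<in> transversal" using transversal_hits[OF t(1)] by blast
    then show "\<exists>y\<in>transversal. depth y = depth x - t" using depth_orb t by metis
  qed
  then obtain y where y: "\<And>t. t \<le> depth x \<Longrightarrow> y t \<in> transversal \<and> depth (y t) = depth x - t"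
    by (metis atMost_iff)
  then have "inj_on y {..depth x}" by (intro inj_onI) (metis atMost_iff diff_diff_cancel)
  then have "card {..depth x} \<le> card transversal"
    using y card_transversal by (intro card_inj_on_le[of y]) auto
  then show ?thesis using card_transversal by simp
qed

text \<open>In a reduced set the orbits with choice up come first in each chain, so the set is described by one
  number per chain. A label \<open>e\<close> stands for the orbit at distance \<open>e div 3\<close> from the singular point
  \<open>base (e mod 3)\<close>; an orbit reached in several ways gets the least label.\<close>

definition reduced :: "int set \<Rightarrow> bool" where
  "reduced S \<longleftrightarrow> (\<forall>x\<in>S. good x \<longrightarrow> x - 1 \<in> S)"

definition base :: "nat \<Rightarrow> int" where "base j = (if j = 0 then 0 else if j = 1 then M else N)"

definition start :: "nat \<Rightarrow> int" where
  "start e = (base (e mod 3) + int (e div 3)) mod (2 * M + 2 * N)"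

definition label :: "int \<Rightarrow> nat" where "label x = (LEAST e. x \<in> orb T (start e))"

definition encoded :: "nat \<Rightarrow> nat \<Rightarrow> nat \<Rightarrow> int set" where
  "encoded k0 k1 k2 = {x \<in> I. label x div 3 <
     (if label x mod 3 = 0 then k0 else if label x mod 3 = 1 then k1 else k2)}"

lemma base_range: "base j \<in> {0, M, N}" by (simp add: base_def)

lemma start_I: "start e \<in> I"
  using M_gt by (auto simp: start_def)

text \<open>Writing a label as \<open>3 * h + j\<close> compares \<open>h\<close> first, so
  minimality of the label forces \<open>h\<close> to be the depth. The bound 18 is 3 times the bound
  6 on the depth.\<close>

lemma label_props:
  assumes "x \<in> I"
  shows "x \<in> orb T (start (label x))" "label x < 18 * gcd m n"
    "label x div 3 = depth x" "base (label x mod 3) + int (depth x) \<in> orb T x"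
proof -
  obtain b where b: "b \<in> {0, M, N}" "b + int (depth x) \<in> orb T x"
    using depth_witness[OF assms] by metis
  define j :: nat where "j = (if b = 0 then 0 else if b = M then 1 else 2)"
  have j: "j < 3" "base j = b" using b M_gt by (auto simp: j_def base_def)
  define e where "e = 3 * depth x + j"
  have e: "e div 3 = depth x" "e mod 3 = j" using j by (auto simp: e_def)
  have "start e = b + int (depth x)" 
    unfolding start_def e j using orb_I[OF assms b(2)] by auto
  then have xe: "x \<in> orb T (start e)" using b(2) T.orb_sym[OF assms] by simp
  then show l: "x \<in> orb T (start (label x))" unfolding label_def by (rule LeastI)
  have le: "label x \<le> e" unfolding label_def using xe by (rule Least_le)
  then show "label x < 18 * gcd m n" using depth_less[OF assms] j by (auto simp: e_def)
  let ?h = "label x div 3" and ?j = "label x mod 3"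
  have h: "?h \<le> depth x" using div_le_mono[OF le, of 3] e by simp
  have l': "start (label x) \<in> orb T x" using T.orb_sym[OF start_I l] .
  \<comment> \<open>The reduction in \<open>start\<close> keeps all labels inside \<open>I\<close>,
    but a least label never wraps: otherwise the orbit would contain a point at distance less than
    \<open>?h\<close> above \<open>0\<close>, contradicting \<open>?h \<le> depth x\<close>.\<close>
  have "base ?j + int ?h < 2 * M + 2 * N"
  proof (rule ccontr)
    assume c: "\<not> ?thesis"
    have bl: "base ?j < 2 * M + 2 * N" "0 \<le> base ?j" using base_range[of ?j] M_gt N_gt by auto
    have "depth x < 2 * M + 2 * N"
      using depth_diff[OF assms order_refl] assms by auto
    then have "(base ?j + int ?h - (2 * M + 2 * N)) mod (2 * M + 2 * N)
        = base ?j + int ?h - (2 * M + 2 * N)"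
      using c h bl by (intro mod_pos_pos_trivial) linarith+
    then have "start (label x) = base ?j + int ?h - (2 * M + 2 * N)"
      by (simp only: start_def minus_mod_self2)
    then have "0 + int (nat (base ?j + int ?h - (2 * M + 2 * N))) \<in> orb T x"
      using l' c by simp
    from depth_le[OF _ this] have "depth x \<le> nat (base ?j + int ?h - (2 * M + 2 * N))" by simp
    then show False using h bl c by linarith
  qed
  moreover have "0 \<le> base ?j" using base_range[of ?j] by auto
  ultimately have "start (label x) = base ?j + int ?h" by (simp add: start_def)
  then have in_orb: "base ?j + int ?h \<in> orb T x" using l' by simp
  then have "depth x \<le> ?h" using depth_le base_range by blast
  with h show "?h = depth x" by simp
  with in_orb show "base ?j + int (depth x) \<in> orb T x" by simp
qed

lemma encoded_invariant: "invariant (encoded k0 k1 k2)"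
proof -
  have label_T: "label (T x) = label x" if "x \<in> I" for x
  proof -
    have "T x \<in> orb T (start e) \<longleftrightarrow> x \<in> orb T (start e)" for e
      using invariant_orb_I[OF start_I] that by (auto simp: invariant_def)
    then show ?thesis by (simp add: label_def)
  qed
  have "T x \<in> encoded k0 k1 k2 \<longleftrightarrow> x \<in> encoded k0 k1 k2" if "x \<in> I" for x
    unfolding encoded_def mem_Collect_eq label_T[OF that] using that T_I[OF that] by (simp only: simp_thms)
  moreover have "encoded k0 k1 k2 \<subseteq> I" unfolding encoded_def by blast
  ultimately show ?thesis unfolding invariant_def by blast
qed

text \<open>An orbit is judged by its point \<open>base j + h\<close> with \<open>h\<close> its
  depth. If that point is in \<open>S\<close>, then so are all points between it and
  \<open>base j\<close>, since positive depth means good. So \<open>S\<close> is determined by its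
  first gap above each of the three base points.\<close>

lemma reduced_encoded:
  assumes S: "invariant S" "reduced S"
  obtains k0 k1 k2 where "k0 \<le> 6 * gcd m n" "k1 \<le> 6 * gcd m n" "k2 \<le> 6 * gcd m n"
    "S = encoded k0 k1 k2"
proof -
  \<comment> \<open>The cap ensures that the minimum exists; all depths lie below it, so it cuts off
    no orbit.\<close>
  let ?P = "\<lambda>j k. k = 6 * gcd m n \<or> base j + int k \<notin> S"
  define k where "k j = (LEAST k. ?P j k)" for j
  have k_le: "k j \<le> 6 * gcd m n" for j
    unfolding k_def by (rule Least_le) simp
  have S_iff: "x \<in> S \<longleftrightarrow> depth x < k (label x mod 3)" if x: "x \<in> I" for x
  proof -
    let ?j = "label x mod 3" and ?h = "depth x"
    let ?y = "base ?j + int ?h"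
    note lp = label_props[OF x]
    have y: "?y \<in> I" "depth ?y = ?h" using orb_I[OF x lp(4)] depth_orb[OF x lp(4)] by auto
    have "x \<in> S \<longleftrightarrow> ?y \<in> S" using invariant_orb[OF S(1) x lp(4)] by simp
    also have "\<dots> \<longleftrightarrow> ?h < k ?j"
    proof
      assume "?h < k ?j"
      then have "\<not> ?P ?j ?h" unfolding k_def by (rule not_less_Least)
      then show "?y \<in> S" by simp
    next
      assume yS: "?y \<in> S"
      have down: "?y - int t \<in> S" if "t \<le> ?h" for t
        using that
      proof (induction t)
        case (Suc t)
        have "depth (?y - int t) = ?h - t" using depth_diff[OF y(1)] y(2) Suc.prems by auto
        then have "good (?y - int t)" using Suc.prems by (intro depth_pos_good) auto
        then have "?y - int t - 1 \<in> S" using S(2) Suc by (auto simp: reduced_def)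
        then show ?case by (simp add: algebra_simps)
      qed (use yS in simp)
      have "\<not> ?P ?j t" if "t \<le> ?h" for t
        using down[of "?h - t"] that depth_less[OF x] by (simp add: of_nat_diff)
      moreover have "?P ?j (k ?j)" unfolding k_def by (rule LeastI[of _ "6 * gcd m n"]) simp
      ultimately show "?h < k ?j" by (meson not_le)
    qed
    finally show ?thesis .
  qed
  have k_cases: "k (label x mod 3) =
      (if label x mod 3 = 0 then k 0 else if label x mod 3 = 1 then k 1 else k 2)" for x
  proof -
    consider "label x mod 3 = 0" | "label x mod 3 = 1" | "label x mod 3 = 2" by linarith
    then show ?thesis by cases simp_all
  qed
  have "x \<in> S \<longleftrightarrow> x \<in> encoded (k 0) (k 1) (k 2)" for x
  proof (cases "x \<in> I")
    case True
    show ?thesis unfolding S_iff[OF True] encoded_def k_cases mem_Collect_eq label_props(3)[OF True]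
      using True by (simp only: simp_thms)
  next
    case False
    then show ?thesis using S(1) by (auto simp: encoded_def invariant_def)
  qed
  then have "S = encoded (k 0) (k 1) (k 2)" by blast
  with k_le that show ?thesis by blast
qed

end

section \<open>Walks on the torus\<close>

context torus
begin

abbreviation U :: "cell \<Rightarrow> cell" where "U \<equiv> up n m"
abbreviation R :: "cell \<Rightarrow> cell" where "R \<equiv> right n m"
abbreviation V :: "cell set" where "V \<equiv> cells n m"

lemma mod_double: "0 < k \<Longrightarrow> c < 2 * k \<Longrightarrow> (c + k) mod (2 * k) = (if c < k then c + k else c - k)"
  for c k :: nat
  by (auto simp: mod_if)

lemma finite_V: "finite V"
  by (simp add: cells_def)

lemma up_eq:
  assumes "c < 2 * m"
  shows "U (i, c) = (if i \<ge> 1 then (i - 1, c) else (2 * n - 1, if c < m then c + m else c - m))"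
  using assms m_gt by (simp add: mod_double)

lemma right_eq:
  assumes "i < 2 * n"
  shows "R (i, c) = (if c < 2 * m - 1 then (i, c + 1) else (if i < n then i + n else i - n, 0))"
  using assms n_gt by (simp add: mod_double)

declare up.simps [simp del] right.simps [simp del]

lemma up_V: "\<alpha> \<in> V \<Longrightarrow> U \<alpha> \<in> V"
  using n_gt m_gt by (cases \<alpha>) (auto simp: cells_def up_eq)

lemma right_V: "\<alpha> \<in> V \<Longrightarrow> R \<alpha> \<in> V"
  using n_gt m_gt by (cases \<alpha>) (auto simp: cells_def right_eq)

lemma up_inj: "inj_on U V"
  using n_gt m_gt by (auto simp: inj_on_def cells_def up_eq split: if_splits)

lemma right_inj: "inj_on R V"
  using n_gt m_gt by (auto simp: inj_on_def cells_def right_eq split: if_splits)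

lemma up_neq_right: "\<alpha> \<in> V \<Longrightarrow> U \<alpha> \<noteq> R \<alpha>"
  using n_gt m_gt by (cases \<alpha>) (auto simp: cells_def up_eq right_eq split: if_splits)

text \<open>Up and right both lower the value by 1 inside the square. The top right corner gets 0
  and the bottom left corner \<open>2 * M + 2 * N - 2\<close>, so the last point of \<open>I\<close>
  carries no cell.\<close>

definition diag :: "cell \<Rightarrow> int" where
  "diag = (\<lambda>(i, c). int i - int c + 2 * M - 1)"

lemma diag_I: "\<alpha> \<in> V \<Longrightarrow> diag \<alpha> \<in> I"
  by (cases \<alpha>) (auto simp: cells_def diag_def)

lemma diag_up:
  assumes "\<alpha> \<in> V"
  shows "diag (U \<alpha>) = (if fst \<alpha> = 0 then T (diag \<alpha>) - 1 else diag \<alpha> - 1)"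
  using assms n_gt m_gt
  by (cases \<alpha>) (auto simp: cells_def up_eq diag_def T_def iet_def of_nat_diff)

text \<open>Leaving through the top applies \<open>T\<close>, leaving through the right side applies
  its inverse. Up to the usual shift by 1, both moves therefore stay in the same orbit of
  diagonals.\<close>

lemma diag_right:
  assumes "\<alpha> \<in> V"
  shows "if snd \<alpha> = 2 * m - 1 then diag (R \<alpha>) + 1 \<in> I \<and> T (diag (R \<alpha>) + 1) = diag \<alpha>
    else diag (R \<alpha>) = diag \<alpha> - 1"
  using assms n_gt m_gt
  by (cases \<alpha>) (auto simp: cells_def right_eq diag_def T_def iet_def of_nat_diff)

text \<open>The order matters only at \<open>(0, m - 1)\<close>, \<open>(0, 2 * m - 1)\<close> and
  \<open>(n, 2 * m - 1)\<close>, where the two crossings of the boundary interfere. Their diagonals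
  are \<open>M\<close>, \<open>0\<close> and \<open>N\<close>.\<close>

lemma up_right_commute:
  assumes "\<alpha> \<in> V" "diag \<alpha> \<notin> {0, M, N}"
  shows "U (R \<alpha>) = R (U \<alpha>)"
proof -
  obtain i c where \<alpha>: "\<alpha> = (i, c)" by (cases \<alpha>)
  have ic: "i < 2 * n" "c < 2 * m" using assms(1) by (auto simp: \<alpha> cells_def)
  consider "i \<ge> 1" "c < 2 * m - 1" | "i \<ge> 1" "c = 2 * m - 1" | "i = 0" "c < 2 * m - 1"
    | "i = 0" "c = 2 * m - 1"
    using ic by linarith
  then show ?thesis
  proof cases
    case 1
    then show ?thesis using ic by (simp add: \<alpha> up_eq right_eq)
  next
    case 2
    then have "i \<noteq> n" using assms(2) m_gt by (auto simp: \<alpha> diag_def of_nat_diff)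
    then show ?thesis using 2 ic n_gt m_gt by (auto simp: \<alpha> up_eq right_eq)
  next
    case 3
    then have "c \<noteq> m - 1" using assms(2) m_gt by (auto simp: \<alpha> diag_def of_nat_diff)
    then show ?thesis using 3 ic n_gt m_gt by (auto simp: \<alpha> up_eq right_eq)
  next
    case 4
    then show ?thesis using assms(2) m_gt by (auto simp: \<alpha> diag_def of_nat_diff)
  qed
qed

section \<open>Walks steered by an invariant set of diagonals\<close>

definition walk :: "int set \<Rightarrow> cell \<Rightarrow> cell" where
  "walk S \<alpha> = (if diag \<alpha> \<in> S then U \<alpha> else R \<alpha>)"

lemma walk_V: "walk S \<in> V \<rightarrow> V"
  by (auto simp: walk_def up_V right_V)

lemma diag_up_orb: "\<alpha> \<in> V \<Longrightarrow> diag (U \<alpha>) + 1 \<in> orb T (diag \<alpha>)"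
  by (auto simp: diag_up orb_self intro: orb_step)

lemma diag_right_orb: "\<alpha> \<in> V \<Longrightarrow> diag (R \<alpha>) + 1 \<in> orb T (diag \<alpha>)"
  using diag_right[of \<alpha>] T.orb_sym[OF _ orb_step[OF orb_self], of "diag (R \<alpha>) + 1"]
  by (auto simp: orb_self split: if_splits)

lemma diag_walk_orb: "\<alpha> \<in> V \<Longrightarrow> diag (walk S \<alpha>) + 1 \<in> orb T (diag \<alpha>)"
  by (simp add: walk_def diag_up_orb diag_right_orb)

text \<open>A collision would be \<open>U \<alpha> = R \<beta>\<close> with different choices. But
  both diagonals share their orbit with the diagonal of the common image plus 1, and an invariant
  set does not split orbits.\<close>

lemma walk_perm:
  assumes "invariant S" shows "finite_perm (walk S) V"
proof
  have ne: "U \<alpha> \<noteq> R \<beta>" if "\<alpha> \<in> V" "\<beta> \<in> V" "diag \<alpha> \<in> S" "diag \<beta> \<notin> S" for \<alpha> \<beta>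
    using that invariant_orb[OF assms diag_I diag_up_orb] invariant_orb[OF assms diag_I diag_right_orb]
    by metis
  show "inj_on (walk S) V"
  proof (rule inj_onI)
    fix \<alpha> \<beta> assume \<alpha>\<beta>: "\<alpha> \<in> V" "\<beta> \<in> V" and eq: "walk S \<alpha> = walk S \<beta>"
    consider "diag \<alpha> \<in> S" "diag \<beta> \<in> S" | "diag \<alpha> \<notin> S" "diag \<beta> \<notin> S"
      using eq ne[OF \<alpha>\<beta>] ne[OF \<alpha>\<beta>(2,1)] unfolding walk_def by metis
    then show "\<alpha> = \<beta>"
    proof cases
      case 1
      then show ?thesis using eq inj_onD[OF up_inj _ \<alpha>\<beta>] by (simp add: walk_def)
    next
      case 2
      then show ?thesis using eq inj_onD[OF right_inj _ \<alpha>\<beta>] by (simp add: walk_def)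
    qed
  qed
qed (use finite_V walk_V in auto)

lemma invariant_swap:
  assumes "invariant S" "x \<in> I" "y \<in> I"
  shows "invariant (S - orb T x \<union> orb T y)"
  using assms invariant_orb_I[OF assms(2)] invariant_orb_I[OF assms(3)]
  unfolding invariant_def by blast

text \<open>Away from the singularity the moves up and right commute, so exchanging the choices on two
  adjacent orbits only affects which cell of the second orbit is visited in between.\<close>

lemma single_cycle_swap:
  assumes S: "invariant S" "single_cycle (walk S) V" and x: "x \<in> S" "good x" "x - 1 \<notin> S"
  shows "single_cycle (walk (S - orb T x \<union> orb T (x - 1))) V"
proof -
  define S' where "S' = S - orb T x \<union> orb T (x - 1)"
  have xI: "x \<in> I" "x - 1 \<in> I" using S(1) x pred_I by (auto simp: invariant_def)
  have S': "invariant S'" unfolding S'_def using invariant_swap S(1) xI by blast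
  have in_S: "orb T x \<subseteq> S" "orb T (x - 1) \<inter> S = {}"
    using invariant_orb[OF S(1)] xI x by blast+
  interpret g: finite_perm "walk S" V using walk_perm S(1) .
  interpret g': finite_perm "walk S'" V using walk_perm S' .
  define D where "D = {\<alpha> \<in> V. diag \<alpha> \<in> orb T x}"
  define E where "E = {\<alpha> \<in> V. diag \<alpha> \<in> orb T (x - 1)}"
  \<comment> \<open>Whatever the choices, a move shifts the orbit of the diagonal by -1; so
    \<open>E\<close> is entered exactly from \<open>D\<close>.\<close>
  have E_iff: "walk Z \<alpha> \<in> E \<longleftrightarrow> \<alpha> \<in> D" if \<alpha>: "\<alpha> \<in> V" for Z \<alpha>
  proof -
    have o: "diag (walk Z \<alpha>) + 1 \<in> orb T (diag \<alpha>)" using diag_walk_orb \<alpha> .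
    have "walk Z \<alpha> \<in> E \<longleftrightarrow> diag (walk Z \<alpha>) + 1 \<in> orb T x"
      using funcset_mem[OF walk_V \<alpha>, of Z] orb_pred[OF xI(1) x(2)]
      by (force simp: E_def)
    also have "\<dots> \<longleftrightarrow> diag \<alpha> \<in> orb T x"
      using invariant_orb[OF invariant_orb_I[OF xI(1)] diag_I[OF \<alpha>] o] .
    finally show ?thesis using \<alpha> by (simp add: D_def)
  qed
  have DE: "D \<inter> E = {}" using in_S by (auto simp: D_def E_def)
  have same: "walk S' \<alpha> = walk S \<alpha>" if "\<alpha> \<in> V" "\<alpha> \<notin> D" "\<alpha> \<notin> E" for \<alpha>
    using that by (auto simp: walk_def S'_def D_def E_def)
  have twice: "walk S' (walk S' \<alpha>) = walk S (walk S \<alpha>)" if "\<alpha> \<in> D" for \<alpha>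
  proof -
    have \<alpha>: "\<alpha> \<in> V" "diag \<alpha> \<in> orb T x" using that by (auto simp: D_def)
    have "walk Z \<alpha> \<in> E" for Z using E_iff[OF \<alpha>(1)] that by simp
    then have "diag (walk S \<alpha>) \<notin> S" "diag (walk S' \<alpha>) \<in> S'" using in_S by (auto simp: E_def S'_def)
    moreover have "diag \<alpha> \<in> S" "diag \<alpha> \<notin> S'" using in_S \<alpha>(2) by (auto simp: S'_def)
    ultimately show ?thesis
      using up_right_commute[OF \<alpha>(1)] good_avoids(2)[OF xI(1) x(2) \<alpha>(2)] by (simp add: walk_def)
  qed
  \<comment> \<open>Seen only outside \<open>E\<close> both walks are the same: they agree off
    \<open>D\<close>, and from \<open>D\<close> two steps end at the same cell, once via up and
    right, once via right and up.\<close>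
  have reach: "(walk S ^^ k) \<alpha> \<in> orb (walk S') \<alpha>"
    if "\<alpha> \<in> V" "\<alpha> \<notin> E" "(walk S ^^ k) \<alpha> \<notin> E" for k \<alpha>
    using that
  proof (induction k arbitrary: \<alpha> rule: less_induct)
    case (less k)
    show ?case
    proof (cases "k = 0")
      case False
      then obtain k' where k': "k = Suc k'" by (cases k) auto
      have 1: "walk S \<alpha> \<in> V" using funcset_mem[OF walk_V less.prems(1)] .
      show ?thesis
      proof (cases "\<alpha> \<in> D")
        case False
        then have "walk S \<alpha> \<notin> E" "walk S' \<alpha> = walk S \<alpha>" using E_iff same less.prems by auto
        moreover have "(walk S ^^ k') (walk S \<alpha>) \<in> orb (walk S') (walk S \<alpha>)"
          using less.IH[of k' "walk S \<alpha>"] less.prems 1 calculation k' by (simp add: funpow_swap1)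
        moreover have "walk S \<alpha> \<in> orb (walk S') \<alpha>" 
          using orb_step[OF orb_self, of "walk S'" \<alpha>] calculation by simp
        ultimately show ?thesis using orb_trans k' by (metis comp_apply funpow_Suc_right)
      next
        case True
        then have e: "walk S \<alpha> \<in> E" using E_iff less.prems by auto
        then have "k' \<noteq> 0" using less.prems k' by (cases k') auto
        then obtain k'' where k'': "k' = Suc k''" by (cases k') auto
        let ?\<beta> = "walk S (walk S \<alpha>)"
        have \<beta>: "?\<beta> \<in> V" "?\<beta> \<notin> E" using funcset_mem[OF walk_V 1] E_iff[OF 1] DE e by auto
        have k_eq: "(walk S ^^ k) \<alpha> = (walk S ^^ k'') ?\<beta>"
          by (simp add: k' k'' funpow_swap1)
        then have "(walk S ^^ k'') ?\<beta> \<in> orb (walk S') ?\<beta>"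
          using less.IH[of k'' ?\<beta>] less.prems \<beta> k' k'' by simp
        moreover have "?\<beta> \<in> orb (walk S') \<alpha>"
          using orb_step[OF orb_step[OF orb_self], of "walk S'" \<alpha>] twice[OF True] by simp
        ultimately show ?thesis using orb_trans k_eq by metis
      qed
    qed (simp add: orb_self)
  qed
  have "\<beta> \<in> orb (walk S') \<alpha>" if \<alpha>: "\<alpha> \<in> V" and \<beta>: "\<beta> \<in> V" for \<alpha> \<beta>
  proof -
    have reach2: "\<beta> \<in> orb (walk S') \<alpha>" if "\<alpha> \<in> V" "\<alpha> \<notin> E" "\<beta> \<in> V" "\<beta> \<notin> E" for \<alpha> \<beta>
    proof -
      have "\<beta> \<in> orb (walk S) \<alpha>" using S(2) that(1,3) by (auto simp: single_cycle_def)
      then obtain k where "\<beta> = (walk S ^^ k) \<alpha>" unfolding orb_def by blast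
      then show ?thesis using reach[OF that(1,2)] that(4) by simp
    qed
    \<comment> \<open>As \<open>D\<close> and \<open>E\<close> are disjoint, a cell of
      \<open>E\<close> has its successor and its predecessor outside \<open>E\<close>, so both ends
      of the required path can be moved off \<open>E\<close>.\<close>
    obtain \<alpha>' where \<alpha>': "\<alpha>' \<in> orb (walk S') \<alpha>" "\<alpha>' \<in> V" "\<alpha>' \<notin> E"
    proof (cases "\<alpha> \<in> E")
      case True
      then have "walk S' \<alpha> \<notin> E" using E_iff[OF \<alpha>, of S'] DE by auto
      then show ?thesis by (rule that[OF orb_step[OF orb_self] funcset_mem[OF walk_V \<alpha>]])
    next
      case False
      then show ?thesis by (rule that[OF orb_self \<alpha>])
    qed
    obtain \<beta>' where \<beta>': "\<beta> \<in> orb (walk S') \<beta>'" "\<beta>' \<in> V" "\<beta>' \<notin> E"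
    proof (cases "\<beta> \<in> E")
      case True
      obtain \<gamma> where \<gamma>: "\<gamma> \<in> V" "walk S' \<gamma> = \<beta>" using g'.image_eq \<beta> by (metis imageE)
      then have "\<gamma> \<notin> E" using E_iff[OF \<gamma>(1), of S'] DE True by auto
      moreover have "\<beta> \<in> orb (walk S') \<gamma>" using orb_step[OF orb_self, of "walk S'" \<gamma>] \<gamma>(2) by simp
      ultimately show ?thesis using that \<gamma>(1) by simp
    next
      case False
      then show ?thesis by (rule that[OF orb_self \<beta>])
    qed
    show ?thesis
      using orb_trans[OF orb_trans[OF \<alpha>'(1) reach2[OF \<alpha>'(2,3) \<beta>'(2,3)]] \<beta>'(1)] .
  qed
  then show ?thesis unfolding single_cycle_def S'_def by blast
qed

text \<open>Replacing an orbit by its translate lowers the sum of the elements of \<open>S\<close>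
  by the size of that orbit. A set of minimal sum therefore admits no further exchange.\<close>

lemma exists_reduced:
  assumes "invariant S" "single_cycle (walk S) V"
  obtains S' where "invariant S'" "reduced S'" "single_cycle (walk S') V"
proof -
  let ?P = "\<lambda>S. invariant S \<and> single_cycle (walk S) V"
  obtain S where S: "?P S" and min: "\<And>S'. ?P S' \<Longrightarrow> nat (\<Sum>S) \<le> nat (\<Sum>S')"
    using exists_least_iff[of "\<lambda>k. \<exists>S. ?P S \<and> nat (\<Sum>S) = k"] assms
    by (metis (no_types, lifting) not_le)
  have "reduced S"
  proof (rule ccontr)
    assume "\<not> reduced S"
    then obtain x where x: "x \<in> S" "good x" "x - 1 \<notin> S" by (auto simp: reduced_def)
    have SI: "S \<subseteq> I" using S by (simp add: invariant_def)
    have xI: "x \<in> I" "x - 1 \<in> I" using SI x pred_I by auto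
    let ?S' = "S - orb T x \<union> orb T (x - 1)"
    have in_S: "orb T x \<subseteq> S" "orb T (x - 1) \<inter> S = {}"
      using invariant_orb[of S] S xI x by blast+
    have S': "?P ?S'" using invariant_swap single_cycle_swap S x xI by blast
    have fin: "finite S" "finite (orb T x)" "finite (orb T (x - 1))"
      using SI in_S orb_subset[OF T.maps xI(2)] finite_subset[of _ I] by auto
    have "\<Sum>?S' = \<Sum>S - \<Sum>(orb T x) + \<Sum>(orb T (x - 1))"
      using in_S fin by (subst sum.union_disjoint) (auto simp: sum_diff)
    also have "\<Sum>(orb T (x - 1)) = (\<Sum>y\<in>orb T x. y - 1)"
      unfolding orb_pred[OF xI(1) x(2)] by (subst sum.reindex) auto
    also have "\<dots> = \<Sum>(orb T x) - int (card (orb T x))"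
      by (simp add: sum_subtractf)
    finally have "\<Sum>?S' = \<Sum>S - int (card (orb T x))" by simp
    moreover have "card (orb T x) > 0" using fin orb_self[of x T] by (auto simp: card_gt_0_iff)
    moreover have "\<Sum>?S' \<ge> 0"
      using S' by (intro sum_nonneg) (auto simp: invariant_def)
    ultimately have "nat (\<Sum>?S') < nat (\<Sum>S)" by linarith
    with min[OF S'] show False by simp
  qed
  with S that show ?thesis by blast
qed

text \<open>A permutation choosing up or right at each cell makes equal choices at \<open>\<alpha>\<close> and \<open>\<beta>\<close> whenever
  \<open>up \<alpha> = right \<beta>\<close>, hence along diagonals. The diagonal \<open>2 m + 2 n - 1\<close> has no cell, and inherits its
  choice from the next one.\<close>

lemma choice_is_walk:
  assumes f: "\<And>\<alpha>. \<alpha> \<in> V \<Longrightarrow> f \<alpha> = U \<alpha> \<or> f \<alpha> = R \<alpha>" and inj: "inj_on f V"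
  obtains S where "invariant S" "\<And>\<alpha>. \<alpha> \<in> V \<Longrightarrow> f \<alpha> = walk S \<alpha>"
proof -
  define s where "s \<alpha> \<longleftrightarrow> f \<alpha> = U \<alpha>" for \<alpha>
  have fV: "f \<in> V \<rightarrow> V" using f up_V right_V by (metis Pi_I)
  interpret f: finite_perm f V using finite_V inj fV by unfold_locales
  have f_eq: "f \<alpha> = (if s \<alpha> then U \<alpha> else R \<alpha>)" if "\<alpha> \<in> V" for \<alpha>
    using f[OF that] by (auto simp: s_def)
  \<comment> \<open>The common image has only \<open>\<alpha>\<close> and \<open>\<beta>\<close> as
    possible predecessors. Injectivity forbids using both, surjectivity forbids using
    neither.\<close>
  have share: "s \<alpha> = s \<beta>" if \<alpha>: "\<alpha> \<in> V" and \<beta>: "\<beta> \<in> V" and eq: "U \<alpha> = R \<beta>" for \<alpha> \<beta>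
  proof
    assume "s \<alpha>"
    show "s \<beta>"
    proof (rule ccontr)
      assume "\<not> s \<beta>"
      then have "f \<alpha> = f \<beta>" using \<open>s \<alpha>\<close> f_eq \<alpha> \<beta> eq by simp
      then have "\<alpha> = \<beta>" using inj \<alpha> \<beta> by (auto dest: inj_onD)
      then show False using up_neq_right \<alpha> eq by simp
    qed
  next
    assume "s \<beta>"
    obtain \<gamma> where \<gamma>: "\<gamma> \<in> V" "f \<gamma> = U \<alpha>" using f.image_eq up_V[OF \<alpha>] by (metis imageE)
    show "s \<alpha>"
    proof (cases "s \<gamma>")
      case True
      then have "\<gamma> = \<alpha>" using \<gamma> f_eq inj_onD[OF up_inj _ \<gamma>(1) \<alpha>] by simp
      then show ?thesis using True by simp
    next
      case False
      then have "\<gamma> = \<beta>" using \<gamma> f_eq eq inj_onD[OF right_inj _ \<gamma>(1) \<beta>] by simp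
      then show ?thesis using False \<open>s \<beta>\<close> by simp
    qed
  qed
  \<comment> \<open>The upper left end of a diagonal, in row 0 or column 0; any other cell of the
    diagonal is joined to it by steps to the upper left.\<close>
  define cell :: "int \<Rightarrow> cell" where
    "cell x = (if x < 2 * M then (0, nat (2 * M - 1 - x)) else (nat (x - 2 * M + 1), 0))" for x
  have diagonal: "s (i, c) = s (cell (diag (i, c)))" if "(i, c) \<in> V" for i c
    using that
  proof (induction i arbitrary: c)
    case 0
    have "cell (diag (0, c)) = (0, c)" using 0 by (auto simp: cell_def diag_def cells_def)
    then show ?case by simp
  next
    case (Suc i)
    show ?case
    proof (cases c)
      case 0
      have "cell (diag (Suc i, 0)) = (Suc i, 0)" by (auto simp: cell_def diag_def)
      then show ?thesis using 0 by simp
    next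
      case (Suc c')
      have "(i, c') \<in> V" "U (Suc i, c) = R (i, c')" "diag (i, c') = diag (Suc i, c)"
        using Suc.prems Suc by (auto simp: cells_def up_eq right_eq diag_def)
      then show ?thesis using Suc.IH[of c'] share[of "(Suc i, c)" "(i, c')"] Suc.prems by simp
    qed
  qed
  \<comment> \<open>\<open>N - 1\<close> is the image under \<open>T\<close> of the diagonal without
    cells, whose preimage is \<open>M - 1\<close>.\<close>
  define S where "S = {x \<in> I. s (cell (if x = 2 * M + 2 * N - 1 then N - 1 else x))}"
  have "s (cell (if T x = 2 * M + 2 * N - 1 then N - 1 else T x)) \<longleftrightarrow>
      s (cell (if x = 2 * M + 2 * N - 1 then N - 1 else x))" if x: "x \<in> I" for x
  proof -
    have step: ?thesis if "\<alpha> \<in> V" "\<beta> \<in> V" "U \<alpha> = R \<beta>" "cell x = \<alpha>" "x \<noteq> 2 * M + 2 * N - 1"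
      "diag \<beta> = (if T x = 2 * M + 2 * N - 1 then N - 1 else T x)" for \<alpha> \<beta>
      using share[OF that(1-3)] diagonal[of "fst \<beta>" "snd \<beta>"] that by simp
    consider "x < M" "x \<noteq> M - 1" | "x = M - 1" | "M \<le> x" "x < 2*M"
      | "2*M \<le> x" "x < 2*M+N" | "2*M+N \<le> x" "x < 2*M + 2*N - 1" | "x = 2*M + 2*N - 1" 
      using x by fastforce
    then show ?thesis
    proof cases
      case 1
      define c where "c = nat (2 * M - 1 - x)"
      have c: "c > m" "c < 2 * m" "x = 2 * M - 1 - int c" using 1 x by (auto simp: c_def)
      show ?thesis
        using 1 c n_gt by (intro step[of "(0, c)" "(2 * n - 1, c - m - 1)"])
          (auto simp: cells_def up_eq right_eq cell_def diag_def T_def iet_def of_nat_diff)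
    next
      case 2
      then show ?thesis
        using n_gt m_gt by (intro step[of "(0, m)" "(n - 1, 2 * m - 1)"])
          (auto simp: cells_def up_eq right_eq cell_def diag_def T_def iet_def of_nat_diff)
    next
      case 3
      define c where "c = nat (2 * M - 1 - x)"
      have c: "c < m" "x = 2 * M - 1 - int c" using 3 x by (auto simp: c_def)
      show ?thesis
        using 3 c n_gt m_gt by (intro step[of "(0, c)" "(2 * n - 1, c + m - 1)"])
          (auto simp: cells_def up_eq right_eq cell_def diag_def T_def iet_def of_nat_diff)
    next
      case 4
      define i where "i = nat (x - 2 * M)"
      have i: "i < n" "x = 2 * M + int i" using 4 x by (auto simp: i_def)
      show ?thesis
        using 4 i n_gt m_gt by (intro step[of "(i + 1, 0)" "(i + n, 2 * m - 1)"])
          (auto simp: cells_def up_eq right_eq cell_def diag_def T_def iet_def of_nat_diff)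
    next
      case 5
      define i where "i = nat (x - 2 * M)"
      have i: "n \<le> i" "i < 2 * n - 1" "x = 2 * M + int i" using 5 x by (auto simp: i_def)
      show ?thesis
        using 5 i n_gt m_gt by (intro step[of "(i + 1, 0)" "(i - n, 2 * m - 1)"])
          (auto simp: cells_def up_eq right_eq cell_def diag_def T_def iet_def of_nat_diff)
    next
      case 6
      then show ?thesis using N_gt M_gt by (auto simp: T_def iet_def)
    qed
  qed
  then have inv: "invariant S" using T_I unfolding invariant_def S_def by blast
  have "f \<alpha> = walk S \<alpha>" if "\<alpha> \<in> V" for \<alpha>
  proof -
    obtain i c where \<alpha>: "\<alpha> = (i, c)" by (cases \<alpha>)
    have "diag \<alpha> \<noteq> 2 * M + 2 * N - 1" using that by (auto simp: \<alpha> diag_def cells_def)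
    then have "diag \<alpha> \<in> S \<longleftrightarrow> s \<alpha>" using diag_I[OF that] diagonal[of i c] that by (simp add: S_def \<alpha>)
    then show ?thesis using f_eq[OF that] by (simp add: walk_def)
  qed
  with inv that show ?thesis by blast
qed

end

section \<open>The interval exchange of a walk\<close>

definition cnt :: "int set \<Rightarrow> int \<Rightarrow> int \<Rightarrow> int" where
  "cnt S x y = int (card (S \<inter> {x..<y}))"

lemma cnt_split: "x \<le> y \<Longrightarrow> y \<le> z \<Longrightarrow> cnt S x z = cnt S x y + cnt S y z"
proof -
  assume "x \<le> y" "y \<le> z"
  then have "S \<inter> {x..<z} = (S \<inter> {x..<y}) \<union> (S \<inter> {y..<z})" by auto
  then show ?thesis unfolding cnt_def by (simp add: card_Un_disjoint Int_Un_distrib disjoint_iff)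
qed

lemma cnt_empty [simp]: "cnt S x x = 0"
  by (simp add: cnt_def)

lemma cnt_single: "cnt S x (x + 1) = (if x \<in> S then 1 else 0)"
proof -
  have "{x..<x + 1} = {x}" by auto
  then show ?thesis by (simp add: cnt_def)
qed

lemma cnt_Suc: "x \<le> y \<Longrightarrow> cnt S x (y + 1) = cnt S x y + (if y \<in> S then 1 else 0)"
  using cnt_split[of x y "y + 1" S] by (simp add: cnt_single)

lemma cnt_nonneg: "0 \<le> cnt S x y"
  by (simp add: cnt_def)

lemma cnt_le: "x \<le> y \<Longrightarrow> cnt S x y \<le> y - x"
  using card_mono[of "{x..<y}" "S \<inter> {x..<y}"] by (simp add: cnt_def)

lemma cnt_mono: "x \<le> y \<Longrightarrow> y \<le> z \<Longrightarrow> cnt S x y \<le> cnt S x z"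
  using cnt_split[of x y z S] cnt_nonneg[of S y z] by simp

lemma cnt_shift:
  assumes "\<And>z. x \<le> z \<Longrightarrow> z < y \<Longrightarrow> z + d \<in> S \<longleftrightarrow> z \<in> S"
  shows "cnt S (x + d) (y + d) = cnt S x y"
proof -
  have "z \<in> (\<lambda>z. z + d) ` (S \<inter> {x..<y})" if "z \<in> S" "x + d \<le> z" "z < y + d" for z
    using assms[of "z - d"] that by (intro image_eqI[of _ _ "z - d"]) auto
  then have "S \<inter> {x + d..<y + d} = (\<lambda>z. z + d) ` (S \<inter> {x..<y})"
    using assms by auto
  then show ?thesis unfolding cnt_def by (simp add: card_image)
qed

lemma orb_all_imp_single_cycle:
  assumes "finite_perm f A" "x \<in> A" "orb f x = A" shows "single_cycle f A"
  unfolding single_cycle_def using finite_perm.orb_eq[OF assms(1,2)] assms(3) by auto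

locale torus_walk = torus +
  fixes S :: "int set"
  assumes inv: "invariant S"
begin

text \<open>A line can leave through the top at column \<open>c\<close>, where the diagonal is
  \<open>2 * M - 1 - c\<close>, or through the right side at row \<open>i\<close>, where it is
  \<open>i\<close>. So \<open>a1\<close>, \<open>a2\<close> count the exits through the left and
  right half of the top, \<open>b1\<close>, \<open>b2\<close> those through the upper and lower half
  of the right side.\<close>

definition a1 :: int where "a1 = cnt S M (2 * M)"
definition a2 :: int where "a2 = cnt S 0 M"
definition b1 :: int where "b1 = N - cnt S 0 N"
definition b2 :: int where "b2 = N - cnt S N (2 * N)"

text \<open>Lines are numbered by their exits from the bottom right corner up the right side and
  then leftwards along the top, hence the order \<open>b2\<close>, \<open>b1\<close>,
  \<open>a2\<close>, \<open>a1\<close>.\<close>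

definition E :: "int \<Rightarrow> int" where "E = iet b2 b1 a2 a1"

text \<open>A step inside the square lowers \<open>cnt S 0 (diag \<alpha> + 1)\<close> and the row of \<open>\<alpha>\<close> by the same amount, so
  the straight pieces of the walk are the level sets of \<open>line\<close>.\<close>

definition line :: "cell \<Rightarrow> int" where
  "line \<alpha> = cnt S 0 (diag \<alpha> + 1) - int (fst \<alpha>) + b1 + b2 - 1"

lemma nonneg: "a1 \<ge> 0" "a2 \<ge> 0" "b1 \<ge> 0" "b2 \<ge> 0"
  using cnt_le[of 0 N S] cnt_le[of N "2*N" S]
  by (auto simp: a1_def a2_def b1_def b2_def cnt_nonneg)

lemma sum_le: "a1 + a2 + b1 + b2 \<le> 2 * M + 2 * N"
  using cnt_le[of 0 M S] cnt_le[of M "2*M" S] cnt_nonneg[of S 0 N] cnt_nonneg[of S N "2*N"]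
  by (auto simp: a1_def a2_def b1_def b2_def)

lemma cnt_2M: "cnt S 0 (2 * M) = a2 + a1"
  using cnt_split[of 0 M "2 * M" S] by (simp add: a1_def a2_def)

lemma cnt_2N: "cnt S 0 (2 * N) = 2 * N - b1 - b2"
  using cnt_split[of 0 N "2 * N" S] by (simp add: b1_def b2_def)

lemma T_mem: "x \<in> I \<Longrightarrow> T x \<in> S \<longleftrightarrow> x \<in> S"
  using inv by (simp add: invariant_def)

text \<open>This and the next three lemmas carry counts across the gluing. \<open>T\<close> takes
  the diagonals of the top to those of the bottom, and those of the left side to those of the right
  side, and \<open>S\<close> is invariant under it.\<close>

lemma cnt_A:
  assumes "0 \<le> x" "x \<le> M" shows "cnt S (2 * N + M) (2 * N + M + x) = cnt S 0 x"
proof -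
  have "z + (2 * N + M) \<in> S \<longleftrightarrow> z \<in> S" if "0 \<le> z" "z < x" for z
  proof -
    have "T z = z + (2 * N + M)" using that assms by (simp add: T_def iet_def)
    then show ?thesis using T_mem[of z] that assms by simp
  qed
  then show ?thesis using cnt_shift[of 0 x "2 * N + M" S] by (simp add: algebra_simps)
qed

lemma cnt_B:
  assumes "M \<le> x" "x \<le> 2 * M" shows "cnt S (2 * N) (2 * N + x - M) = cnt S M x"
proof -
  have "z + (2 * N - M) \<in> S \<longleftrightarrow> z \<in> S" if "M \<le> z" "z < x" for z
  proof -
    have "T z = z + (2 * N - M)" using that assms by (simp add: T_def iet_def)
    then show ?thesis using T_mem[of z] that assms by simp
  qed
  then show ?thesis using cnt_shift[of M x "2 * N - M" S] by (simp add: algebra_simps)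
qed

lemma cnt_C:
  assumes "N \<le> x" "x \<le> 2 * N" shows "cnt S (2 * M) (2 * M + x - N) = cnt S N x"
proof -
  have "z + (2 * M - N) \<in> S \<longleftrightarrow> z \<in> S" if "N \<le> z" "z < x" for z
  proof -
    have "T (z + (2 * M - N)) = z" using that assms M_gt by (simp add: T_def iet_def)
    then show ?thesis using T_mem[of "z + (2 * M - N)"] that assms by simp
  qed
  then show ?thesis using cnt_shift[of N x "2 * M - N" S] by (simp add: algebra_simps)
qed

lemma cnt_D:
  assumes "0 \<le> x" "x \<le> N" shows "cnt S (2 * M + N) (2 * M + N + x) = cnt S 0 x"
proof -
  have "z + (2 * M + N) \<in> S \<longleftrightarrow> z \<in> S" if "0 \<le> z" "z < x" for z
  proof -
    have "T (z + (2 * M + N)) = z" using that assms M_gt N_gt by (simp add: T_def iet_def)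
    then show ?thesis using T_mem[of "z + (2 * M + N)"] that assms by simp
  qed
  then show ?thesis using cnt_shift[of 0 x "2 * M + N" S] by (simp add: algebra_simps)
qed

lemma line_inside:
  assumes \<alpha>: "\<alpha> \<in> V" and up: "diag \<alpha> \<in> S \<Longrightarrow> fst \<alpha> \<ge> 1"
    and right: "diag \<alpha> \<notin> S \<Longrightarrow> snd \<alpha> < 2 * m - 1"
  shows "diag (walk S \<alpha>) = diag \<alpha> - 1" "line (walk S \<alpha>) = line \<alpha>"
proof -
  have d: "diag \<alpha> \<ge> 0" using diag_I[OF \<alpha>] by simp
  obtain i c where ic: "\<alpha> = (i, c)" "i < 2 * n" "c < 2 * m" using \<alpha> by (cases \<alpha>) (auto simp: cells_def)
  show 1: "diag (walk S \<alpha>) = diag \<alpha> - 1"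
    using up right ic by (auto simp: walk_def up_eq right_eq diag_def of_nat_diff)
  show "line (walk S \<alpha>) = line \<alpha>"
    unfolding line_def 1 using up right ic cnt_Suc[OF d, of S]
    by (auto simp: walk_def up_eq right_eq of_nat_diff)
qed

text \<open>One case per half-side. The count at the re-entry cell is split at the ends of the
  half-sides and carried back to the exit side; strict bounds on the exit count then select the
  branch of \<open>iet\<close>.\<close>

lemma line_wrap:
  assumes \<alpha>: "\<alpha> \<in> V" and wrap: "if diag \<alpha> \<in> S then fst \<alpha> = 0 else snd \<alpha> = 2 * m - 1"
  shows "line (walk S \<alpha>) = E (line \<alpha>)"
proof -
  obtain i c where ic: "\<alpha> = (i, c)" "i < 2 * n" "c < 2 * m" using \<alpha> by (cases \<alpha>) (auto simp: cells_def)
  show ?thesis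
  proof (cases "diag \<alpha> \<in> S")
    case True
    then have i: "i = 0" using wrap ic by simp
    define x where "x = 2 * M - 1 - int c"
    have x: "0 \<le> x" "x < 2 * M" "diag \<alpha> = x" "x \<in> S"
      using True ic i by (auto simp: x_def diag_def algebra_simps)
    have l: "line \<alpha> = cnt S 0 x + b1 + b2" using x cnt_Suc[of 0 x S] by (simp add: line_def ic i)
    show ?thesis
    proof (cases "c < m")
      case False
      then have xM: "x < M" using ic by (simp add: x_def)
      have w: "walk S \<alpha> = (2 * n - 1, c - m)" using True ic False i by (simp add: walk_def up_eq)
      have "diag (walk S \<alpha>) + 1 = 2 * N + M + x"
        using False n_gt by (simp add: w diag_def x_def of_nat_diff)
      moreover have "cnt S 0 (2 * N + M + x) = 2 * N - b1 - b2 + a1 + cnt S 0 x"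
        using cnt_split[of 0 "2 * N + M" "2 * N + M + x" S] cnt_split[of 0 "2 * N" "2 * N + M" S]
          cnt_A[of x] cnt_B[of "2 * M"] cnt_2N x xM by (simp add: a1_def add.commute)
      ultimately have "line (walk S \<alpha>) = a1 + cnt S 0 x"
        using n_gt by (simp add: line_def w of_nat_diff)
      moreover have "cnt S 0 x < a2"
        using cnt_mono[of 0 "x + 1" M S] cnt_Suc[of 0 x S] x xM by (simp add: a2_def)
      ultimately show ?thesis
        using l nonneg cnt_nonneg[of S 0 x] by (simp add: E_def iet_def)
    next
      case True
      then have xM: "x \<ge> M" by (simp add: x_def)
      have w: "walk S \<alpha> = (2 * n - 1, c + m)" using \<open>diag \<alpha> \<in> S\<close> ic True i by (simp add: walk_def up_eq)
      have "diag (walk S \<alpha>) + 1 = 2 * N + x - M"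
        using True n_gt by (simp add: w diag_def x_def of_nat_diff)
      moreover have "cnt S 0 (2 * N + x - M) = 2 * N - b1 - b2 + cnt S M x"
        using cnt_split[of 0 "2 * N" "2 * N + x - M" S] cnt_B[of x] cnt_2N x xM by simp
      ultimately have "line (walk S \<alpha>) = cnt S M x"
        using n_gt by (simp add: line_def w of_nat_diff)
      moreover have "cnt S 0 x = a2 + cnt S M x"
        using cnt_split[of 0 M x S] xM by (simp add: a2_def)
      ultimately show ?thesis
        using l nonneg cnt_nonneg[of S M x] by (simp add: E_def iet_def)
    qed
  next
    case False
    then have c: "c = 2 * m - 1" using wrap ic by simp
    have x: "diag \<alpha> = int i" "int i \<notin> S" using False ic m_gt c by (auto simp: diag_def of_nat_diff)
    have l: "line \<alpha> = cnt S 0 (int i) - int i + b1 + b2 - 1"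
      using x cnt_Suc[of 0 "int i" S] by (simp add: line_def ic)
    show ?thesis
    proof (cases "i < n")
      case True
      have w: "walk S \<alpha> = (i + n, 0)" using False ic True c m_gt by (simp add: walk_def right_eq)
      have "diag (walk S \<alpha>) + 1 = 2 * M + N + int i" by (simp add: w diag_def)
      moreover have "cnt S 0 (2 * M + N + int i) = a1 + a2 + (N - b2) + cnt S 0 (int i)"
        using cnt_split[of 0 "2 * M + N" "2 * M + N + int i" S] cnt_split[of 0 "2 * M" "2 * M + N" S]
          cnt_C[of "2 * N"] cnt_D[of "int i"] cnt_2M True by (simp add: b2_def add.commute)
      ultimately have "line (walk S \<alpha>) = line \<alpha> + a1 + a2 - b2"
        by (simp add: line_def w l[unfolded line_def])
      moreover have "int i - cnt S 0 (int i) < b1"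
        using cnt_split[of 0 "int i + 1" N S] cnt_Suc[of 0 "int i" S] x True
          cnt_le[of "int i + 1" N S] by (simp add: b1_def)
      moreover have "cnt S 0 (int i) \<le> int i" using cnt_le[of 0 "int i" S] by simp
      ultimately show ?thesis using l nonneg by (simp add: E_def iet_def)
    next
      case False
      have w: "walk S \<alpha> = (i - n, 0)" using \<open>diag \<alpha> \<notin> S\<close> ic False c m_gt by (simp add: walk_def right_eq)
      have "diag (walk S \<alpha>) + 1 = 2 * M + int i - N" using False by (simp add: w diag_def of_nat_diff)
      moreover have "cnt S 0 (2 * M + int i - N) = a1 + a2 + cnt S N (int i)"
        using cnt_split[of 0 "2 * M" "2 * M + int i - N" S] cnt_C[of "int i"] cnt_2M False ic by simp
      moreover have s: "cnt S 0 (int i) = N - b1 + cnt S N (int i)"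
        using cnt_split[of 0 N "int i" S] False by (simp add: b1_def)
      ultimately have "line (walk S \<alpha>) = line \<alpha> + a1 + a2 + b1"
        using False by (simp add: line_def w l[unfolded line_def] of_nat_diff)
      moreover have "cnt S N (int i) \<le> int i - N" using cnt_le[of N "int i" S] False by simp
      then have "line \<alpha> < b2" using l s by simp
      ultimately show ?thesis by (simp add: E_def iet_def)
    qed
  qed
qed

lemma line_range:
  assumes "\<alpha> \<in> V" shows "0 \<le> line \<alpha>" "line \<alpha> < b2 + b1 + a2 + a1"
proof -
  obtain i c where ic: "\<alpha> = (i, c)" "i < 2 * n" "c < 2 * m" using assms by (cases \<alpha>) (auto simp: cells_def)
  let ?x = "diag \<alpha>"
  have x: "int i \<le> ?x" "?x + 1 \<le> 2 * M + int i" using ic by (auto simp: diag_def)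
  have "cnt S 0 (?x + 1) \<le> a1 + a2 + int i"
    using cnt_mono[of 0 "?x + 1" "2 * M + int i" S] cnt_split[of 0 "2 * M" "2 * M + int i" S] 
      cnt_le[of "2 * M" "2 * M + int i" S] cnt_2M x by simp
  then show "line \<alpha> < b2 + b1 + a2 + a1" by (simp add: line_def ic)
  have "2 * N - b1 - b2 \<le> cnt S 0 (int i + 1) + (2 * N - int i - 1)"
    using cnt_split[of 0 "int i + 1" "2 * N" S] cnt_le[of "int i + 1" "2 * N" S] cnt_2N ic by simp
  then show "0 \<le> line \<alpha>"
    using cnt_mono[of 0 "int i + 1" "?x + 1" S] x by (simp add: line_def ic)
qed

text \<open>A discrete intermediate value argument along the right side upwards and the top
  leftwards: \<open>line\<close> starts at 0, ends at the last number, and changes by at most 1 per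
  cell.\<close>

lemma line_surj:
  assumes "0 \<le> y" "y < b2 + b1 + a2 + a1"
  obtains \<alpha> where "\<alpha> \<in> V" "line \<alpha> = y"
proof -
  define c where "c j = (if j \<le> 2 * n - 1 then (2 * n - 1 - j, 2 * m - 1)
      else (0, 2 * m - 1 - (j - (2 * n - 1))))" for j
  let ?l = "2 * n - 1 + (2 * m - 1)"
  have "\<bar>line (c (Suc j)) - line (c j)\<bar> \<le> 1" if "0 \<le> j \<and> j < ?l" for j
  proof (cases "j < 2 * n - 1")
    case True
    then show ?thesis using cnt_Suc[of 0 "2 * N - 1 - int j - 1 + 1" S] n_gt m_gt
      by (auto simp: c_def line_def diag_def of_nat_diff)
  next
    case False
    define k where "k = j - (2 * n - 1)"
    have k: "j = 2 * n - 1 + k" "k < 2 * m - 1" using False that by (auto simp: k_def)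
    have "c j = (0, 2 * m - 1 - k)" "c (Suc j) = (0, 2 * m - 1 - Suc k)" using k by (auto simp: c_def)
    then show ?thesis using cnt_Suc[of 0 "int k + 1" S] k
      by (auto simp: line_def diag_def of_nat_diff)
  qed
  moreover have "line (c 0) = 0"
    using cnt_2N n_gt m_gt by (simp add: c_def line_def diag_def of_nat_diff)
  moreover have "line (c ?l) = b2 + b1 + a2 + a1 - 1"
    using cnt_2M n_gt m_gt by (simp add: c_def line_def diag_def of_nat_diff)
  ultimately obtain j where "j \<le> ?l" "line (c j) = y"
    using nat_intermed_int_val[of 0 ?l "\<lambda>j. line (c j)" y] assms by auto
  moreover have "c j \<in> V" using n_gt m_gt by (auto simp: c_def cells_def)
  ultimately show ?thesis using that by blast
qed

lemma E_perm: "finite_perm E {0..<b2 + b1 + a2 + a1}"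
  unfolding E_def using iet_perm nonneg by simp

text \<open>Within the square a step keeps \<open>line\<close> and lowers \<open>diag\<close> by 1,
  and the two values together determine the cell. So the walk must arrive at \<open>\<beta>\<close>,
  provided it stays inside until then.\<close>

lemma same_line:
  assumes "\<alpha> \<in> V" "\<beta> \<in> V" "line \<alpha> = line \<beta>" "diag \<beta> \<le> diag \<alpha>"
  shows "\<beta> \<in> orb (walk S) \<alpha>"
  using assms
proof (induction "nat (diag \<alpha> - diag \<beta>)" arbitrary: \<alpha>)
  case 0
  then have d: "diag \<alpha> = diag \<beta>" by simp
  then have "fst \<alpha> = fst \<beta>" using 0 by (simp add: line_def)
  then have "\<alpha> = \<beta>" using d by (cases \<alpha>; cases \<beta>) (auto simp: diag_def)
  then show ?case by (simp add: orb_self)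
next
  case (Suc k)
  obtain i c where \<alpha>: "\<alpha> = (i, c)" by (cases \<alpha>)
  obtain i' c' where \<beta>: "\<beta> = (i', c')" by (cases \<beta>)
  let ?x = "diag \<alpha>" and ?x' = "diag \<beta>"
  have x: "?x' < ?x" "0 \<le> ?x'" using Suc.hyps diag_I[OF Suc.prems(2)] by auto
  have eq: "int i = int i' + cnt S (?x' + 1) (?x + 1)"
    using Suc.prems(3) cnt_split[of 0 "?x' + 1" "?x + 1" S] x by (simp add: line_def \<alpha> \<beta>)
  have s: "cnt S (?x' + 1) (?x + 1) = cnt S (?x' + 1) ?x + (if ?x \<in> S then 1 else 0)"
    using x by (intro cnt_Suc) auto
  \<comment> \<open>It does stay inside: when the step is up, \<open>\<beta>\<close> lies in a
    strictly higher row; when it is to the right, in a column strictly further right.\<close>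
  have up: "fst \<alpha> \<ge> 1" if "?x \<in> S"
    using eq s that cnt_nonneg[of S "?x' + 1" ?x] by (simp add: \<alpha>)
  have right: "snd \<alpha> < 2 * m - 1" if "?x \<notin> S"
  proof -
    have "int i \<le> int i' + (?x - ?x' - 1)" using eq s that cnt_le[of "?x' + 1" ?x S] x by simp
    then have "c < c'" by (simp add: \<alpha> \<beta> diag_def)
    then show ?thesis using Suc.prems(2) by (auto simp: \<alpha> \<beta> cells_def)
  qed
  note step = line_inside[OF Suc.prems(1) up right]
  have "\<beta> \<in> orb (walk S) (walk S \<alpha>)"
    using Suc.hyps x step Suc.prems funcset_mem[OF walk_V Suc.prems(1), of S]
    by (intro Suc.hyps(1)) auto
  then show ?case using orb_trans[OF orb_step[OF orb_self]] by metis
qed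

lemma line_step:
  assumes "\<alpha> \<in> V" shows "line (walk S \<alpha>) = line \<alpha> \<or> line (walk S \<alpha>) = E (line \<alpha>)"
proof -
  have "snd \<alpha> \<le> 2 * m - 1" using assms by (auto simp: cells_def)
  then show ?thesis
    using line_inside(2)[OF assms] line_wrap[OF assms] by (cases "diag \<alpha> \<in> S") fastforce+
qed

lemma next_line:
  assumes "\<alpha> \<in> V" obtains \<beta> where "\<beta> \<in> orb (walk S) \<alpha>" "line \<beta> = E (line \<alpha>)"
proof -
  have "\<exists>\<beta>\<in>orb (walk S) \<alpha>. line \<beta> = E (line \<alpha>)"
    using assms
  proof (induction "nat (diag \<alpha>)" arbitrary: \<alpha> rule: less_induct)
    case less
    have next_orb: "walk S \<alpha> \<in> orb (walk S) \<alpha>" using orb_step[OF orb_self] .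
    show ?case
    proof (cases "if diag \<alpha> \<in> S then fst \<alpha> = 0 else snd \<alpha> = 2 * m - 1")
      case True
      then show ?thesis using line_wrap[OF less.prems] next_orb by blast
    next
      case False
      have "snd \<alpha> \<le> 2 * m - 1" using less.prems by (auto simp: cells_def)
      with False have side: "diag \<alpha> \<in> S \<Longrightarrow> fst \<alpha> \<ge> 1" "diag \<alpha> \<notin> S \<Longrightarrow> snd \<alpha> < 2 * m - 1"
        by (auto split: if_splits)
      note step = line_inside[OF less.prems side]
      have V: "walk S \<alpha> \<in> V" using funcset_mem[OF walk_V less.prems] .
      have "nat (diag (walk S \<alpha>)) < nat (diag \<alpha>)" using step(1) diag_I[OF V] by simp
      from less.hyps[OF this V] obtain \<beta> where "\<beta> \<in> orb (walk S) (walk S \<alpha>)" "line \<beta> = E (line \<alpha>)"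
        using step(2) by auto
      then show ?thesis using orb_trans[OF next_orb] by blast
    qed
  qed
  then show ?thesis using that by blast
qed

text \<open>\<open>E\<close> is the walk modulo lines: each step stays on its line or follows
  \<open>E\<close>, every line is eventually left towards its \<open>E\<close>-image, and all cells
  of a line share an orbit.\<close>

lemma single_cycle_walk_iff:
  "single_cycle (walk S) V \<longleftrightarrow> orb E 0 = {0..<b2 + b1 + a2 + a1}"
proof
  interpret E: finite_perm E "{0..<b2 + b1 + a2 + a1}" by (rule E_perm)
  have "(0, 0) \<in> V" using n_gt m_gt by (simp add: cells_def)
  then have pos: "0 \<in> {0..<b2 + b1 + a2 + a1}" using line_range[of "(0, 0)"] by simp
  {
    assume single: "single_cycle (walk S) V"
    obtain \<alpha> where \<alpha>: "\<alpha> \<in> V" "line \<alpha> = 0" using line_surj[of 0] pos by auto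
    have reach: "line ((walk S ^^ k) \<alpha>) \<in> orb E 0" for k
    proof (induction k)
      case (Suc k)
      then show ?case using line_step[OF funpow_mem[OF walk_V \<alpha>(1)], of k S] orb_step by fastforce
    qed (use \<alpha> orb_self in simp)
    have "y \<in> orb E 0" if y: "y \<in> {0..<b2 + b1 + a2 + a1}" for y
    proof -
      obtain \<beta> where \<beta>: "\<beta> \<in> V" "line \<beta> = y"
        using line_surj[of y] y unfolding atLeastLessThan_iff by blast
      then have "\<beta> \<in> orb (walk S) \<alpha>" using single \<alpha> by (auto simp: single_cycle_def)
      then obtain k where "\<beta> = (walk S ^^ k) \<alpha>" unfolding orb_def by blast
      then show ?thesis using reach[of k] \<beta>(2) by simp
    qed
    then show "orb E 0 = {0..<b2 + b1 + a2 + a1}" using orb_subset[OF E.maps pos] by blast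
  next
    assume all: "orb E 0 = {0..<b2 + b1 + a2 + a1}"
    interpret w: finite_perm "walk S" V using walk_perm[OF inv] .
    have "\<beta> \<in> orb (walk S) \<alpha>" if \<alpha>: "\<alpha> \<in> V" and \<beta>: "\<beta> \<in> V" for \<alpha> \<beta>
    proof -
      have sub: "orb (walk S) \<alpha> \<subseteq> V" using orb_subset[OF walk_V \<alpha>] .
      have lines: "\<exists>\<gamma>\<in>orb (walk S) \<alpha>. line \<gamma> = (E ^^ k) (line \<alpha>)" for k
      proof (induction k)
        case 0
        show ?case using orb_self[of \<alpha> "walk S"] by auto
      next
        case (Suc k)
        then obtain \<gamma> where \<gamma>: "\<gamma> \<in> orb (walk S) \<alpha>" "line \<gamma> = (E ^^ k) (line \<alpha>)" by blast
        obtain \<delta> where "\<delta> \<in> orb (walk S) \<gamma>" "line \<delta> = E (line \<gamma>)" using next_line \<gamma> sub by blast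
        then show ?case using orb_trans[OF \<gamma>(1)] \<gamma>(2) by (metis comp_apply funpow.simps(2))
      qed
      have "line \<beta> \<in> orb E (line \<alpha>)"
        using orb_all_imp_single_cycle[OF E_perm pos all] line_range[OF \<alpha>] line_range[OF \<beta>]
        unfolding single_cycle_def by (metis atLeastLessThan_iff subsetD)
      then obtain k where "line \<beta> = (E ^^ k) (line \<alpha>)" by (auto simp: orb_def)
      with lines[of k] obtain \<gamma> where \<gamma>: "\<gamma> \<in> orb (walk S) \<alpha>" "line \<gamma> = line \<beta>" by auto
      have "\<gamma> \<in> V" using \<gamma>(1) sub by blast
      have "\<beta> \<in> orb (walk S) \<gamma>"
      proof (cases "diag \<beta> \<le> diag \<gamma>")
        case True
        then show ?thesis using same_line \<gamma> \<open>\<gamma> \<in> V\<close> \<beta> by blast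
      next
        case False
        then have "\<gamma> \<in> orb (walk S) \<beta>" using same_line[OF \<beta> \<open>\<gamma> \<in> V\<close>] \<gamma> by simp
        then show ?thesis using w.orb_sym \<beta> by blast
      qed
      then show ?thesis using orb_trans[OF \<gamma>(1)] by blast
    qed
    then show "single_cycle (walk S) V" by (auto simp: single_cycle_def)
  }
qed

end

section \<open>Hamiltonian cycles as walks\<close>

lemma cas_steps:
  assumes "pre_digraph.cas G u p v" "p \<noteq> []"
  shows "tail G (p ! 0) = u" "head G (last p) = v"
    "\<And>j. Suc j < length p \<Longrightarrow> tail G (p ! Suc j) = head G (p ! j)"
proof -
  have "tail G (p ! 0) = u \<and> head G (last p) = v \<and>
      (\<forall>j. Suc j < length p \<longrightarrow> tail G (p ! Suc j) = head G (p ! j))"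
    using assms
  proof (induction p arbitrary: u)
    case (Cons a p)
    show ?case
    proof (cases "p = []")
      case True
      then show ?thesis using Cons.prems by (simp add: pre_digraph.cas.simps)
    next
      case False
      have a: "tail G a = u" and p: "pre_digraph.cas G (head G a) p v"
        using Cons.prems by (simp_all add: pre_digraph.cas.simps)
      note IH = Cons.IH[OF p False]
      have "tail G ((a # p) ! Suc j) = head G ((a # p) ! j)" if "Suc j < length (a # p)" for j
        using IH that by (cases j) auto
      then show ?thesis using a IH False by simp
    qed
  qed simp
  then show "tail G (p ! 0) = u" "head G (last p) = v"
    "\<And>j. Suc j < length p \<Longrightarrow> tail G (p ! Suc j) = head G (p ! j)" by blast+
qed

lemma cas_path: "pre_digraph.cas G (w i) (map (\<lambda>k. (w k, w (Suc k))) [i..<i + l]) (w (i + l))"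
  if "tail G = fst" "head G = snd"
proof (induction l arbitrary: i)
  case (Suc l)
  have "[i..<i + Suc l] = i # [Suc i..<Suc i + l]" by (simp add: upt_conv_Cons)
  then show ?case using Suc[of "Suc i"] that by (simp add: pre_digraph.cas.simps)
qed (simp add: pre_digraph.cas.simps)

context torus
begin

abbreviation G :: "(cell, cell \<times> cell) pre_digraph" where "G \<equiv> torus_graph n m"

lemma G_simps: "verts G = V" "tail G = fst" "head G = snd"
  "(\<alpha>, \<beta>) \<in> arcs G \<longleftrightarrow> \<alpha> \<in> V \<and> (\<beta> = U \<alpha> \<or> \<beta> = R \<alpha>)"
  by (cases \<alpha>; auto simp: torus_graph_def)+

lemma hamiltonian_imp_walk:
  assumes "hamiltonian G"
  obtains S where "invariant S" "single_cycle (walk S) V"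
proof -
  obtain u p u' where aw: "pre_digraph.awalk G u p u" "set (pre_digraph.awalk_verts G u p) = V"
    and d: "distinct (tl (pre_digraph.awalk_verts G u' p))" and ne: "p \<noteq> []"
    using assms unfolding hamiltonian_def pre_digraph.cycle_def by (auto simp: G_simps)
  have cas: "pre_digraph.cas G u p u" and arcs: "set p \<subseteq> arcs G"
    using aw(1) by (auto simp: pre_digraph.awalk_def)
  define L where "L = length p"
  have L: "L > 0" using ne by (simp add: L_def)
  note st = cas_steps[OF cas ne, unfolded G_simps]
  have verts: "pre_digraph.awalk_verts G u p = u # map snd p"
    using pre_digraph.awalk_verts_conv'[OF cas] ne st(1) by (simp add: G_simps hd_conv_nth)
  \<comment> \<open>Periodic enumeration of the arc heads, so that the closing arc is an ordinary
    step.\<close>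
  define w where "w k = snd (p ! (k mod L))" for k
  \<comment> \<open>The notion of cycle carries its own start vertex \<open>u'\<close>; for a
    nonempty arc list the visited vertices do not depend on it.\<close>
  have dist: "distinct (map snd p)"
    using d verts pre_digraph.awalk_verts_ne_eq[OF ne, of G u u'] by simp
  have w_set: "w ` {..<L} = V"
  proof -
    have "u \<in> snd ` set p" using st(2) ne last_in_set by (metis imageI)
    then have "V = snd ` set p" using aw(2) by (simp add: verts insert_absorb)
    also have "set p = (!) p ` {..<L}" by (auto simp: set_conv_nth L_def)
    also have "snd ` (!) p ` {..<L} = w ` {..<L}" unfolding image_image by (simp add: w_def)
    finally show ?thesis ..
  qed
  have w_inj: "w j = w k \<longleftrightarrow> j mod L = k mod L" for j k
    using nth_eq_iff_index_eq[OF dist, of "j mod L" "k mod L"] L by (simp add: w_def L_def)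
  have arc: "(w k, w (Suc k)) \<in> arcs G" for k
  proof -
    have lt: "Suc k mod L < L" using L by simp
    have "fst (p ! (Suc k mod L)) = w k"
    proof (cases "Suc (k mod L) = L")
      case True
      then have "Suc k mod L = 0" by (simp add: mod_Suc)
      moreover have "k mod L = L - 1" using True by linarith
      ultimately show ?thesis using st(1,2) ne by (simp add: w_def last_conv_nth L_def)
    next
      case False
      then have "Suc k mod L = Suc (k mod L)" by (simp add: mod_Suc)
      then show ?thesis using st(3)[of "k mod L"] lt by (simp add: w_def L_def)
    qed
    moreover have "p ! (Suc k mod L) \<in> arcs G" using lt arcs by (auto simp: L_def)
    ultimately show ?thesis by (metis prod.collapse w_def)
  qed
  define f where "f \<alpha> = w (Suc (SOME k. w k = \<alpha>))" for \<alpha>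
  have f_w: "f (w k) = w (Suc k)" for k
  proof -
    define j where "j = (SOME j. w j = w k)"
    have "w j = w k" unfolding j_def by (rule someI) (rule refl)
    then have "j mod L = k mod L" by (simp only: w_inj)
    then have "w (Suc j) = w (Suc k)" unfolding w_inj mod_Suc by simp
    then show ?thesis by (simp only: f_def j_def)
  qed
  have w_ex: "\<exists>k. \<alpha> = w k" if "\<alpha> \<in> V" for \<alpha>
    using that unfolding w_set[symmetric] by (rule imageE) (rule exI)
  have f_choice: "f \<alpha> = U \<alpha> \<or> f \<alpha> = R \<alpha>" if "\<alpha> \<in> V" for \<alpha>
  proof -
    obtain k where k: "\<alpha> = w k" using w_ex \<open>\<alpha> \<in> V\<close> by meson
    show ?thesis unfolding k using arc[of k] f_w[of k] unfolding G_simps(4) by simp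
  qed
  have wV: "w k \<in> V" for k using arc[of k] unfolding G_simps(4) by (rule conjunct1)
  \<comment> \<open>Periodicity supplies a predecessor for every cell; on a finite set, surjectivity
    of the successor map gives the injectivity that \<open>choice_is_walk\<close> asks for.\<close>
  have "V \<subseteq> f ` V"
  proof
    fix \<alpha> assume "\<alpha> \<in> V"
    then obtain k where "\<alpha> = w k" using w_ex by blast
    also have "\<dots> = w (Suc (k + (L - 1)))" using L by (simp add: w_inj)
    finally show "\<alpha> \<in> f ` V" using f_w wV by (metis imageI)
  qed
  moreover have "f ` V \<subseteq> V"
  proof (rule image_subsetI)
    fix \<alpha> assume "\<alpha> \<in> V"
    then show "f \<alpha> \<in> V" using f_choice[of \<alpha>] up_V[of \<alpha>] right_V[of \<alpha>] by metis
  qed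
  ultimately have "f ` V = V" by (rule subset_antisym[rotated])
  then have "inj_on f V" using finite_V by (intro eq_card_imp_inj_on) simp_all
  from choice_is_walk[OF f_choice this] obtain S where
    S: "invariant S" "\<And>\<alpha>. \<alpha> \<in> V \<Longrightarrow> f \<alpha> = walk S \<alpha>" by blast
  have pow: "(walk S ^^ j) (w k) = w (k + j)" for j k
    by (induction j) (auto simp: S(2)[OF wV, symmetric] f_w)
  have "single_cycle (walk S) V"
    unfolding single_cycle_def
  proof (intro ballI subsetI)
    fix \<alpha> \<beta> assume "\<alpha> \<in> V" "\<beta> \<in> V"
    then obtain j k where jk: "\<alpha> = w j" "\<beta> = w k" using w_ex by meson
    have "j \<le> L * j" using L by simp
    then have e: "j + (k + (L * j - j)) = k + L * j" by linarith
    have "\<beta> = (walk S ^^ (k + (L * j - j))) \<alpha>" unfolding jk pow w_inj e by simp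
    then show "\<beta> \<in> orb (walk S) \<alpha>" using orb_funpow by metis
  qed
  with S(1) that show ?thesis by blast
qed

lemma walk_imp_hamiltonian:
  assumes "invariant S" "single_cycle (walk S) V"
  shows "hamiltonian G"
proof -
  interpret w: finite_perm "walk S" V using walk_perm[OF assms(1)] .
  define \<alpha> :: cell where "\<alpha> = (0, 0)"
  have \<alpha>: "\<alpha> \<in> V" using n_gt m_gt by (simp add: \<alpha>_def cells_def)
  define w where "w k = (walk S ^^ k) \<alpha>" for k
  have wV: "w k \<in> V" for k unfolding w_def using funpow_mem[OF walk_V \<alpha>] .
  have w_Suc: "w (Suc k) = walk S (w k)" for k by (simp add: w_def)
  have all: "orb (walk S) \<alpha> = V"
    using assms(2) \<alpha> orb_subset[OF walk_V \<alpha>] by (auto simp: single_cycle_def)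
  define L where "L = card V"
  have "w L = \<alpha>"
  proof -
    obtain k where "k > 0" "k \<le> L" "(walk S ^^ k) \<alpha> = \<alpha>" 
      using w.funpow_return[OF \<alpha>] unfolding L_def by blast
    then show ?thesis using all[unfolded w.orb_eq_all_iff[OF \<alpha>]] by (metis L_def le_neq_implies_less w_def)
  qed
  have "L > 0" using \<alpha> finite_V by (auto simp: L_def card_gt_0_iff)
  have set_w: "w ` {..<L} = V"
    using w.orb_bounded[OF \<alpha>, of L] all by (simp add: L_def w_def)
  define p where "p = map (\<lambda>k. (w k, w (Suc k))) [0..<0 + L]"
  have ne: "p \<noteq> []" using \<open>L > 0\<close> by (simp add: p_def)
  have cas: "pre_digraph.cas G \<alpha> p \<alpha>"
    using cas_path[of G w 0 L] \<open>w L = \<alpha>\<close> unfolding p_def by (simp add: G_simps w_def)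
  have arcs: "set p \<subseteq> arcs G"
    using wV by (auto simp: p_def G_simps w_Suc walk_def)
  have aw: "pre_digraph.awalk G \<alpha> p \<alpha>" unfolding pre_digraph.awalk_def using cas arcs \<alpha> by (simp add: G_simps)
  have verts: "tl (pre_digraph.awalk_verts G \<alpha> p) = map (\<lambda>k. w (Suc k)) [0..<L]"
    using pre_digraph.awalk_verts_conv'[OF cas] ne by (simp add: p_def G_simps)
  have "set (map (\<lambda>k. w (Suc k)) [0..<L]) = walk S ` w ` {..<L}"
    by (auto simp: w_Suc)
  also have "\<dots> = V" using set_w w.image_eq by simp
  finally have set_tl: "set (tl (pre_digraph.awalk_verts G \<alpha> p)) = V" by (simp add: verts)
  have "distinct (tl (pre_digraph.awalk_verts G \<alpha> p))"
    using set_tl by (intro card_distinct) (simp add: verts L_def)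
  moreover have "set (pre_digraph.awalk_verts G \<alpha> p) = V"
    using pre_digraph.awalk_verts_conv'[OF cas] ne set_tl \<alpha> cas_steps(1)[OF cas ne]
    by (auto simp: G_simps hd_conv_nth)
  ultimately show ?thesis
    unfolding hamiltonian_def pre_digraph.cycle_def G_simps(1) using aw ne by blast
qed

text \<open>Forwards, a solution is first reduced and then encoded. Backwards, every triple is
  sound, because each encoded set is invariant whether or not it is reduced.\<close>

lemma hamiltonian_iff_encoded:
  "hamiltonian G \<longleftrightarrow> (\<exists>k0 k1 k2. k0 \<le> 6 * gcd m n \<and> k1 \<le> 6 * gcd m n \<and> k2 \<le> 6 * gcd m n \<and>
     single_cycle (walk (encoded k0 k1 k2)) V)"
proof
  assume "hamiltonian G"
  then obtain S where "invariant S" "single_cycle (walk S) V" by (rule hamiltonian_imp_walk)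
  then obtain S' where "invariant S'" "reduced S'" "single_cycle (walk S') V" by (rule exists_reduced)
  then show "\<exists>k0 k1 k2. k0 \<le> 6 * gcd m n \<and> k1 \<le> 6 * gcd m n \<and> k2 \<le> 6 * gcd m n \<and>
     single_cycle (walk (encoded k0 k1 k2)) V"
    using reduced_encoded[of S'] by metis
next
  assume "\<exists>k0 k1 k2. k0 \<le> 6 * gcd m n \<and> k1 \<le> 6 * gcd m n \<and> k2 \<le> 6 * gcd m n \<and>
     single_cycle (walk (encoded k0 k1 k2)) V"
  then show "hamiltonian G" using walk_imp_hamiltonian encoded_invariant by blast
qed

end

section \<open>Reasoning about programs\<close>

text \<open>A weakest precondition for total correctness whose postcondition also receives the cost,
  so that simplification of straight-line code adds up the operations.\<close>

definition runs :: "com \<Rightarrow> state \<Rightarrow> (nat \<Rightarrow> state \<Rightarrow> bool) \<Rightarrow> bool" where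
  "runs c s Q \<longleftrightarrow> (\<exists>t s'. exec c s t s' \<and> Q t s')"

lemma runs_mono: "runs c s P \<Longrightarrow> (\<And>t s'. P t s' \<Longrightarrow> Q t s') \<Longrightarrow> runs c s Q"
  unfolding runs_def by blast

lemma runs_Skip [simp]: "runs Skip s Q \<longleftrightarrow> Q 0 s"
  unfolding runs_def by (blast intro: exec.Skip elim: exec_SkipE)

lemma runs_Assign [simp]:
  "runs (Assign x a) s Q \<longleftrightarrow> Q (acost a) (s\<lparr>reg := (reg s)(x := aval a s)\<rparr>)"
  unfolding runs_def by (blast intro: exec.Assign elim: exec_AssignE)

lemma runs_Store [simp]:
  "runs (Store a b) s Q \<longleftrightarrow> Q (acost a + acost b) (s\<lparr>mem := (mem s)(aval a s := aval b s)\<rparr>)"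
  unfolding runs_def by (blast intro: exec.Store elim: exec_StoreE)

lemma runs_Seq [simp]:
  "runs (Seq c1 c2) s Q \<longleftrightarrow> runs c1 s (\<lambda>t1 s1. runs c2 s1 (\<lambda>t2. Q (t1 + t2)))"
  unfolding runs_def by (blast intro: exec.Seq elim: exec_SeqE)

lemma runs_If [simp]:
  "runs (If b c1 c2) s Q \<longleftrightarrow>
     (if bval b s then runs c1 s (\<lambda>t. Q (bcost b + t)) else runs c2 s (\<lambda>t. Q (bcost b + t)))"
  unfolding runs_def by (auto intro: exec.IfTrue exec.IfFalse elim!: exec_IfE)

definition For :: "vname \<Rightarrow> vname \<Rightarrow> com \<Rightarrow> com" where
  "For i N c = Seq (Assign i (Const 0))
     (While (Less (Reg i) (Reg N)) (Seq c (Assign i (Add (Reg i) (Const 1)))))"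

abbreviation set_reg :: "state \<Rightarrow> vname \<Rightarrow> int \<Rightarrow> state" where
  "set_reg s x v \<equiv> s\<lparr>reg := (reg s)(x := v)\<rparr>"

text \<open>Besides the body, a round pays 2: one comparison in the guard and one increment. The
  final 1 is the failing guard.\<close>

lemma runs_For:
  assumes init: "P 0 (set_reg s i 0)"
    and body: "\<And>k s. k < K \<Longrightarrow> P k s \<Longrightarrow> reg s i = int k \<Longrightarrow>
      runs c s (\<lambda>t s'. t \<le> B \<and> reg s' i = int k \<and> P (Suc k) (set_reg s' i (int k + 1)))"
    and bound: "\<And>k s. P k s \<Longrightarrow> reg s N = int K"
    and post: "\<And>t s'. P K s' \<Longrightarrow> t \<le> K * (B + 2) + 1 \<Longrightarrow> Q t s'"
  shows "runs (For i N c) s Q"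
proof -
  let ?w = "While (Less (Reg i) (Reg N)) (Seq c (Assign i (Add (Reg i) (Const 1))))"
  have loop: "runs ?w s (\<lambda>t s'. P K s' \<and> t \<le> (K - k) * (B + 2) + 1)"
    if "k \<le> K" "P k s" "reg s i = int k" for k s
    using that
  proof (induction "K - k" arbitrary: k s)
    case 0
    then have "\<not> bval (Less (Reg i) (Reg N)) s" using bound[of k s] by simp
    from exec.WhileFalse[OF this] 0 show ?case unfolding runs_def by fastforce
  next
    case (Suc d)
    then have k: "k < K" by simp
    have b: "bval (Less (Reg i) (Reg N)) s" using bound[of k s] Suc k by simp
    obtain t s' where t: "exec c s t s'" "t \<le> B" "reg s' i = int k" "P (Suc k) (set_reg s' i (int k + 1))"
      using body[OF k Suc.prems(2,3)] unfolding runs_def by blast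
    let ?s = "set_reg s' i (int k + 1)"
    have "exec (Assign i (Add (Reg i) (Const 1))) s' 1 ?s"
      using exec.Assign[of i "Add (Reg i) (Const 1)" s'] t(3) by simp
    from exec.Seq[OF t(1) this] have ex: "exec (Seq c (Assign i (Add (Reg i) (Const 1)))) s (t + 1) ?s" .
    have "runs ?w ?s (\<lambda>t s'. P K s' \<and> t \<le> (K - Suc k) * (B + 2) + 1)"
      using Suc.hyps(2) k t(4) by (intro Suc.hyps(1)) auto
    then obtain t2 s2 where t2: "exec ?w ?s t2 s2" "P K s2" "t2 \<le> (K - Suc k) * (B + 2) + 1"
      unfolding runs_def by blast
    have "K - k = Suc (K - Suc k)" using k by simp
    then have "1 + (t + 1) + t2 \<le> (K - k) * (B + 2) + 1" using t(2) t2(3) by simp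
    with exec.WhileTrue[OF b ex t2(1)] t2(2) show ?case unfolding runs_def by fastforce
  qed
  have "runs ?w (set_reg s i 0) (\<lambda>t s'. P K s' \<and> t \<le> K * (B + 2) + 1)"
    using loop[of 0 "set_reg s i 0"] init by simp
  then show ?thesis unfolding For_def by (simp add: runs_mono post)
qed


section \<open>The program\<close>

definition iet_com :: "vname \<Rightarrow> vname \<Rightarrow> vname \<Rightarrow> vname \<Rightarrow> com" where
  "iet_com w x y z =
    If (Less (Reg ''p'') (Reg w))
      (Assign ''p'' (Add (Add (Add (Reg ''p'') (Reg x)) (Reg y)) (Reg z)))
    (If (Less (Reg ''p'') (Add (Reg w) (Reg x)))
      (Assign ''p'' (Sub (Add (Add (Reg ''p'') (Reg y)) (Reg z)) (Reg w)))
    (If (Less (Reg ''p'') (Add (Add (Reg w) (Reg x)) (Reg y)))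
      (Assign ''p'' (Sub (Sub (Add (Reg ''p'') (Reg z)) (Reg w)) (Reg x)))
      (Assign ''p'' (Sub (Sub (Sub (Reg ''p'') (Reg w)) (Reg x)) (Reg y)))))"

definition switch_com :: "vname \<Rightarrow> aexp \<Rightarrow> aexp \<Rightarrow> aexp \<Rightarrow> com" where
  "switch_com x a b c =
    If (Eq (Mod (Reg ''e'') (Const 3)) (Const 0)) (Assign x a)
    (If (Eq (Mod (Reg ''e'') (Const 3)) (Const 1)) (Assign x b) (Assign x c))"

definition incr_com :: "vname \<Rightarrow> com" where
  "incr_com x = Assign x (Add (Reg x) (Const 1))"

text \<open>Trial division is linear in \<open>m\<close> and hence within the bound. Common divisors
  are met in increasing order, so the last one stored is the greatest.\<close>

definition gcd_com :: com where
  "gcd_com = For ''i'' ''m''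
    (If (And (Eq (Mod (Reg ''m'') (Add (Reg ''i'') (Const 1))) (Const 0))
             (Eq (Mod (Reg ''n'') (Add (Reg ''i'') (Const 1))) (Const 0)))
      (Assign ''g'' (Add (Reg ''i'') (Const 1))) Skip)"

definition mark_com :: com where
  "mark_com = For ''j'' ''q'' (Seq (Store (Reg ''p'') (Reg ''e'')) (iet_com ''m'' ''m'' ''n'' ''n''))"

text \<open>Labels are processed downwards, so that the least label of an orbit is written last.\<close>

definition label_com :: com where
  "label_com = For ''i'' ''l''
    (Seq (Assign ''e'' (Sub (Sub (Reg ''l'') (Const 1)) (Reg ''i'')))
    (Seq (switch_com ''p'' (Const 0) (Reg ''m'') (Reg ''n''))
    (Seq (Assign ''p'' (Mod (Add (Reg ''p'') (Div (Reg ''e'') (Const 3))) (Reg ''q'')))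
      mark_com)))"

definition count_com :: com where
  "count_com = For ''j'' ''q''
    (Seq (Assign ''e'' (Load (Reg ''j'')))
    (Seq (switch_com ''k'' (Reg ''k0'') (Reg ''k1'') (Reg ''k2''))
    (If (Less (Div (Reg ''e'') (Const 3)) (Reg ''k''))
      (If (Less (Reg ''j'') (Reg ''m'')) (incr_com ''a2'')
        (If (Less (Reg ''j'') (Mul (Const 2) (Reg ''m''))) (incr_com ''a1'') Skip))
      (If (Less (Reg ''j'') (Reg ''n'')) (incr_com ''b1'')
        (If (Less (Reg ''j'') (Mul (Const 2) (Reg ''n''))) (incr_com ''b2'') Skip)))))"

text \<open>The register \<open>''c''\<close> holds the number of lines minus 1: a return to 0 after
  at most that many steps is premature.\<close>

definition cycle_com :: com where
  "cycle_com = For ''j'' ''c''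
    (Seq (iet_com ''b2'' ''b1'' ''a2'' ''a1'')
      (If (Eq (Reg ''p'') (Const 0)) (Assign ''ok'' (Const 0)) Skip))"

definition test_com :: com where
  "test_com =
    Seq (Assign ''a1'' (Const 0)) (Seq (Assign ''a2'' (Const 0))
    (Seq (Assign ''b1'' (Const 0)) (Seq (Assign ''b2'' (Const 0))
    (Seq count_com
    (Seq (Assign ''c'' (Sub (Add (Add (Add (Reg ''b2'') (Reg ''b1'')) (Reg ''a2'')) (Reg ''a1'')) (Const 1)))
    (Seq (Assign ''p'' (Const 0)) (Seq (Assign ''ok'' (Const 1))
    (Seq cycle_com
      (If (Eq (Reg ''ok'') (Const 1)) (Assign ''result'' (Const 1)) Skip)))))))))"

text \<open>A single counter runs through all triples, read as three digits in base
  \<open>6 * gcd m n + 1\<close>.\<close>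

definition search_com :: com where
  "search_com = For ''i'' ''v''
    (Seq (Assign ''k0'' (Mod (Reg ''i'') (Reg ''w'')))
    (Seq (Assign ''k1'' (Mod (Div (Reg ''i'') (Reg ''w'')) (Reg ''w'')))
    (Seq (Assign ''k2'' (Div (Div (Reg ''i'') (Reg ''w'')) (Reg ''w'')))
      test_com)))"

definition main_com :: com where
  "main_com =
    Seq (Assign ''q'' (Add (Mul (Const 2) (Reg ''m'')) (Mul (Const 2) (Reg ''n''))))
    (Seq gcd_com
    (Seq (Assign ''l'' (Mul (Const 18) (Reg ''g'')))
    (Seq (Assign ''w'' (Add (Mul (Const 6) (Reg ''g'')) (Const 1)))
    (Seq (Assign ''v'' (Mul (Mul (Reg ''w'') (Reg ''w'')) (Reg ''w'')))
    (Seq label_com search_com)))))"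

section \<open>Correctness and cost of the subprograms\<close>

lemma runs_iet:
  assumes "w \<noteq> ''p''" "x \<noteq> ''p''" "y \<noteq> ''p''" "z \<noteq> ''p''"
    and "\<And>t. t \<le> 9 \<Longrightarrow> Q t (set_reg s ''p'' (iet (reg s w) (reg s x) (reg s y) (reg s z) (reg s ''p'')))"
  shows "runs (iet_com w x y z) s Q"
  using assms(1-4) assms(5)[of 4] assms(5)[of 6] assms(5)[of 9]
  by (auto simp: iet_com_def iet_def eval_nat_numeral)

lemma runs_switch:
  assumes "acost a = 0" "acost b = 0" "acost c = 0"
    and "\<And>t. t \<le> 4 \<Longrightarrow> Q t (set_reg s x (if reg s ''e'' mod 3 = 0 then aval a s
      else if reg s ''e'' mod 3 = 1 then aval b s else aval c s))"
  shows "runs (switch_com x a b c) s Q"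
  using assms(1-3) assms(4)[of 2] assms(4)[of 4] by (auto simp: switch_com_def eval_nat_numeral)

definition frame :: "vname set \<Rightarrow> state \<Rightarrow> state \<Rightarrow> bool" where
  "frame X s s' \<longleftrightarrow> (\<forall>x. x \<notin> X \<longrightarrow> reg s' x = reg s x)"

lemma frameD: "frame X s s' \<Longrightarrow> x \<notin> X \<Longrightarrow> reg s' x = reg s x"
  by (simp add: frame_def)

context torus
begin

definition ready :: "state \<Rightarrow> bool" where
  "ready s \<longleftrightarrow> reg s ''n'' = N \<and> reg s ''m'' = M \<and> reg s ''q'' = 2 * M + 2 * N"

abbreviation Q where "Q \<equiv> 2 * m + 2 * n"

lemma runs_gcd:
  assumes "ready s" "reg s ''result'' = 0"
  shows "runs gcd_com s (\<lambda>t s'. t \<le> m * 9 + 1 \<and> ready s' \<and> reg s' ''result'' = 0 \<and>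
    reg s' ''g'' = int (gcd m n))"
  unfolding gcd_com_def
proof (rule runs_For[where K = m and B = 7 and P = "\<lambda>k s'. ready s' \<and> reg s' ''result'' = 0 \<and>
    (gcd m n \<le> k \<longrightarrow> reg s' ''g'' = int (gcd m n))"])
  fix k s assume s: "ready s \<and> reg s ''result'' = 0 \<and>
    (gcd m n \<le> k \<longrightarrow> reg s ''g'' = int (gcd m n))" "reg s ''i'' = int k"
  have "(M mod (int k + 1) = 0 \<and> N mod (int k + 1) = 0) \<longleftrightarrow> Suc k dvd gcd m n"
  proof -
    have k1: "int k + 1 = int (Suc k)" by simp
    have "M mod (int k + 1) = int (m mod Suc k)" "N mod (int k + 1) = int (n mod Suc k)"
      unfolding k1 by (simp_all only: zmod_int)
    then show ?thesis by (simp only: of_nat_eq_0_iff gcd_greatest_iff mod_eq_0_iff_dvd)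
  qed
  moreover have "Suc k dvd gcd m n \<Longrightarrow> Suc k \<le> gcd m n" using m_gt by (intro dvd_imp_le) auto
  moreover have "gcd m n \<le> Suc k \<Longrightarrow> \<not> Suc k dvd gcd m n \<Longrightarrow> gcd m n \<le> k"
    by (metis dvd_refl le_Suc_eq)
  ultimately show "runs
        (If (And (Eq (Mod (Reg ''m'') (Add (Reg ''i'') (Const 1))) (Const 0))
             (Eq (Mod (Reg ''n'') (Add (Reg ''i'') (Const 1))) (Const 0)))
      (Assign ''g'' (Add (Reg ''i'') (Const 1))) Skip) s
     (\<lambda>t s'. t \<le> 7 \<and> reg s' ''i'' = int k \<and>
         ready (set_reg s' ''i'' (int k + 1)) \<and> reg (set_reg s' ''i'' (int k + 1)) ''result'' = 0 \<and>
         (gcd m n \<le> Suc k \<longrightarrow> reg (set_reg s' ''i'' (int k + 1)) ''g'' = int (gcd m n)))"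
    using s by (auto simp: ready_def)
qed (use assms gcd_le1_nat[of m n] m_gt in \<open>auto simp: ready_def\<close>)

lemma runs_mark:
  assumes "ready s" "x = reg s ''p''" "x \<in> I"
  shows "runs mark_com s (\<lambda>t s'. t \<le> Q * 11 + 1 \<and> frame {''p'', ''j''} s s' \<and>
    mem s' = (\<lambda>y. if y \<in> orb T x then reg s ''e'' else mem s y))"
proof -
  define J where "J k = (\<lambda>j. (T ^^ j) x) ` {..<k}" for k
  have J: "J 0 = {}" "J (Suc k) = insert ((T ^^ k) x) (J k)" "J Q = orb T x" for k
    using T.orb_bounded[OF assms(3), of Q] by (auto simp: J_def lessThan_Suc)
  show ?thesis
    unfolding mark_com_def
  proof (rule runs_For[where K = Q and B = 9 and P = "\<lambda>k s'. frame {''p'', ''j''} s s' \<and>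
      reg s' ''p'' = (T ^^ k) x \<and> mem s' = (\<lambda>y. if y \<in> J k then reg s ''e'' else mem s y)"], goal_cases)
    case 1
    then show ?case using assms by (simp add: frame_def J)
  next
    case (2 k s')
    have r: "reg s' ''m'' = M" "reg s' ''n'' = N" "reg s' ''e'' = reg s ''e''" "reg s' ''p'' = (T ^^ k) x"
      using 2 assms by (auto simp: frame_def ready_def)
    have "(mem s')((T ^^ k) x := reg s ''e'') = (\<lambda>y. if y \<in> J (Suc k) then reg s ''e'' else mem s y)"
      using 2 by (simp add: J(2) fun_eq_iff)
    moreover have "iet M M N N ((T ^^ k) x) = (T ^^ Suc k) x" by (simp add: T_def)
    moreover have "frame {''p'', ''j''} s s'" using 2 by blast
    ultimately show ?case
      unfolding runs_Seq runs_Store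
      by (intro runs_iet) (simp_all add: r 2(3) frame_def del: funpow.simps)
  next
    case (3 k s')
    then show ?case using assms by (simp add: frame_def ready_def)
  next
    case (4 t s')
    then show ?case by (simp add: J)
  qed
qed

lemma runs_label:
  assumes "ready s" "reg s ''l'' = 18 * int (gcd m n)"
  shows "runs label_com s (\<lambda>t s'. t \<le> 18 * gcd m n * (Q * 11 + 12) + 1 \<and>
    frame {''p'', ''j'', ''e'', ''i''} s s' \<and> (\<forall>x\<in>I. mem s' x = int (label x)))"
  unfolding label_com_def
\<comment> \<open>After \<open>k\<close> rounds a point reached by one of the \<open>k\<close>
  largest labels holds the least of these; nothing is claimed for other points. In the end every
  point is reached, since all labels are below \<open>18 * gcd m n\<close>.\<close>
proof (rule runs_For[where K = "18 * gcd m n" and B = "Q * 11 + 10" and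
    P = "\<lambda>k s'. frame {''p'', ''j'', ''e'', ''i''} s s' \<and>
      (\<forall>x\<in>I. (\<exists>e\<ge>18 * gcd m n - k. e < 18 * gcd m n \<and> x \<in> orb T (start e)) \<longrightarrow>
        mem s' x = int (LEAST e. 18 * gcd m n - k \<le> e \<and> x \<in> orb T (start e)))"], goal_cases)
  case 1
  then show ?case by (auto simp: frame_def)
next
  case (2 k s')
  define e where "e = 18 * gcd m n - Suc k"
  have e: "18 * gcd m n - k = Suc e" "int e = 18 * int (gcd m n) - 1 - int k" using 2(1) by (auto simp: e_def of_nat_diff)
  have r: "reg s' ''m'' = M" "reg s' ''n'' = N" "reg s' ''q'' = 2 * M + 2 * N"
      "reg s' ''l'' = 18 * int (gcd m n)"
    using 2 assms by (auto simp: frame_def ready_def)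
  have st: "((if int e mod 3 = 0 then 0 else if int e mod 3 = 1 then M else N) + int e div 3)
      mod (2 * M + 2 * N) = start e"
  proof -
    have "int e mod 3 = int (e mod 3)" "int e div 3 = int (e div 3)" by (simp_all add: zmod_int zdiv_int)
    then show ?thesis by (simp add: start_def base_def)
  qed
  have ee: "aval (Sub (Sub (Reg ''l'') (Const 1)) (Reg ''i'')) s' = int e" by (simp add: r 2(3) e(2))
  have post: "mem s'' x = int (LEAST e'. e \<le> e' \<and> x \<in> orb T (start e'))"
    if mem: "mem s'' = (\<lambda>y. if y \<in> orb T (start e) then int e else mem s' y)"
      and x: "x \<in> I" "e' \<ge> e" "e' < 18 * gcd m n" "x \<in> orb T (start e')" for s'' :: state and x e'
  proof (cases "x \<in> orb T (start e)")
    case True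
    then have "(LEAST e'. e \<le> e' \<and> x \<in> orb T (start e')) = e" by (intro Least_equality) auto
    then show ?thesis using True mem by simp
  next
    case False
    then have "(\<lambda>e'. e \<le> e' \<and> x \<in> orb T (start e')) = (\<lambda>e'. Suc e \<le> e' \<and> x \<in> orb T (start e'))"
      by (auto simp: fun_eq_iff Suc_le_eq le_less)
    moreover have "e' \<ge> Suc e" using False x by (metis le_antisym not_less_eq_eq)
    ultimately show ?thesis using False mem 2(2) x unfolding e(1) by auto
  qed
  show ?case
    unfolding e_def[symmetric] runs_Seq runs_Assign ee
  proof (rule runs_switch, goal_cases)
    case (4 t)
    show ?case
    proof (rule runs_mono[OF runs_mark[of _ "start e"]], goal_cases)
      case 1
      then show ?case by (simp add: ready_def r)
    next
      case 2
      show ?case unfolding st[symmetric] by (simp add: r cong: if_cong split del: if_split)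
    next
      case 3
      then show ?case by (rule start_I)
    next
      case (4 t' s'')
      then have mem: "mem s'' = (\<lambda>y. if y \<in> orb T (start e) then int e else mem s' y)"
        by (simp cong: if_cong split del: if_split)
      have "reg s'' ''i'' = int k" using 4 2(3) by (simp add: frame_def)
      moreover have "frame {''p'', ''j'', ''e'', ''i''} s (set_reg s'' ''i'' (int k + 1))"
        using 4 2(2) by (simp add: frame_def)
      moreover have "\<forall>x\<in>I. (\<exists>e'\<ge>e. e' < 18 * gcd m n \<and> x \<in> orb T (start e')) \<longrightarrow>
          mem s'' x = int (LEAST e'. e \<le> e' \<and> x \<in> orb T (start e'))"
        using post[OF mem] by blast
      ultimately show ?case using 4 \<open>t \<le> 4\<close> by simp
    qed
  qed simp_all
next
  case (3 k s')
  then show ?case using assms by (simp add: frame_def)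
next
  case (4 t s')
  have "mem s' x = int (label x)" if x: "x \<in> I" for x
    using 4(1) x label_props(1,2)[OF x] by (auto simp: label_def)
  moreover have "t \<le> 18 * gcd m n * (Q * 11 + 12) + 1" using 4(2) by (simp add: ac_simps)
  ultimately show ?case using 4(1) by blast
qed

end

text \<open>Capping the upper end lets one loop keep four counters over different ranges: a counter
  is 0 before its range and frozen after it.\<close>

lemma cnt_min_Suc:
  assumes "lo \<le> hi"
  shows "cnt S lo (min (x + 1) hi) = cnt S lo (min x hi) + (if lo \<le> x \<and> x < hi \<and> x \<in> S then 1 else 0)"
proof -
  consider "x < lo" | "lo \<le> x" "x < hi" | "hi \<le> x" by linarith
  then show ?thesis
  proof cases
    case 1
    then have "{lo..<min (x + 1) hi} = {}" "{lo..<min x hi} = {}" by auto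
    then show ?thesis using 1 by (simp add: cnt_def)
  next
    case 2
    then have "min (x + 1) hi = x + 1" "min x hi = x" by auto
    then show ?thesis using 2 cnt_Suc[of lo x S] by simp
  next
    case 3
    then have "min (x + 1) hi = hi" "min x hi = hi" by auto
    then show ?thesis using 3 by simp
  qed
qed

lemma cnt_compl: "x \<le> y \<Longrightarrow> cnt (- S) x y = y - x - cnt S x y"
proof -
  assume "x \<le> y"
  have "S \<inter> {x..<y} \<union> - S \<inter> {x..<y} = {x..<y}" by auto
  then have "card {x..<y} = card (S \<inter> {x..<y}) + card (- S \<inter> {x..<y})"
    using card_Un_disjoint[of "S \<inter> {x..<y}" "- S \<inter> {x..<y}"] by auto
  then show ?thesis using \<open>x \<le> y\<close> by (simp add: cnt_def)
qed

lemma (in torus) runs_count: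
  assumes s: "ready s" "\<forall>x\<in>I. mem s x = int (label x)"
      "reg s ''k0'' = int k0" "reg s ''k1'' = int k1" "reg s ''k2'' = int k2"
      "reg s ''a1'' = 0" "reg s ''a2'' = 0" "reg s ''b1'' = 0" "reg s ''b2'' = 0"
    and S: "S = encoded k0 k1 k2"
  shows "runs count_com s (\<lambda>t s'. t \<le> Q * 12 + 1 \<and>
    frame {''j'', ''e'', ''k'', ''a1'', ''a2'', ''b1'', ''b2''} s s' \<and> mem s' = mem s \<and>
    reg s' ''a1'' = cnt S M (2 * M) \<and> reg s' ''a2'' = cnt S 0 M \<and>
    reg s' ''b1'' = N - cnt S 0 N \<and> reg s' ''b2'' = N - cnt S N (2 * N))"
  unfolding count_com_def
proof (rule runs_For[where K = Q and B = 10 and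
    P = "\<lambda>k s'. frame {''j'', ''e'', ''k'', ''a1'', ''a2'', ''b1'', ''b2''} s s' \<and> mem s' = mem s \<and>
      reg s' ''a1'' = cnt S M (min (int k) (2 * M)) \<and> reg s' ''a2'' = cnt S 0 (min (int k) M) \<and>
      reg s' ''b1'' = cnt (- S) 0 (min (int k) N) \<and>
      reg s' ''b2'' = cnt (- S) N (min (int k) (2 * N))"], goal_cases)
  case 1
  show ?case using s by (simp add: frame_def cnt_def)
next
  case (2 k s')
  let ?x = "int k"
  have x: "?x \<in> I" using 2(1) by auto
  have r: "reg s' ''m'' = M" "reg s' ''n'' = N" "reg s' ''k0'' = int k0" "reg s' ''k1'' = int k1"
      "reg s' ''k2'' = int k2" "mem s' ?x = int (label ?x)"
    using 2 s x by (auto simp: frame_def ready_def)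
  have K: "int (label ?x) div 3 < (if int (label ?x) mod 3 = 0 then int k0
      else if int (label ?x) mod 3 = 1 then int k1 else int k2) \<longleftrightarrow> ?x \<in> S"
  proof -
    have "int (label ?x) mod 3 = int (label ?x mod 3)" "int (label ?x) div 3 = int (label ?x div 3)"
      by (simp_all add: zmod_int zdiv_int)
    then show ?thesis using x by (simp add: S encoded_def)
  qed
  have x0: "0 \<le> ?x" by simp
  have f: "frame {''j'', ''e'', ''k'', ''a1'', ''a2'', ''b1'', ''b2''} s s'" and mem: "mem s' = mem s"
    and c: "reg s' ''a1'' = cnt S M (min ?x (2 * M))" "reg s' ''a2'' = cnt S 0 (min ?x M)"
      "reg s' ''b1'' = cnt (- S) 0 (min ?x N)" "reg s' ''b2'' = cnt (- S) N (min ?x (2 * N))"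
    using 2(2) by auto
  have Suc_k: "int (Suc k) = ?x + 1" by simp
  define A1 where "A1 = cnt S M (min (int (Suc k)) (2 * M))"
  define A2 where "A2 = cnt S 0 (min (int (Suc k)) M)"
  define B1 where "B1 = cnt (- S) 0 (min (int (Suc k)) N)"
  define B2 where "B2 = cnt (- S) N (min (int (Suc k)) (2 * N))"
  note folds = A1_def[symmetric] A2_def[symmetric] B1_def[symmetric] B2_def[symmetric]
  have up: "A1 = reg s' ''a1'' + (if M \<le> ?x \<and> ?x < 2 * M \<and> ?x \<in> S then 1 else 0)"
      "A2 = reg s' ''a2'' + (if ?x < M \<and> ?x \<in> S then 1 else 0)"
      "B1 = reg s' ''b1'' + (if ?x < N \<and> ?x \<notin> S then 1 else 0)"
      "B2 = reg s' ''b2'' + (if N \<le> ?x \<and> ?x < 2 * N \<and> ?x \<notin> S then 1 else 0)"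
    unfolding A1_def A2_def B1_def B2_def Suc_k c
    using cnt_min_Suc[of M "2 * M" S ?x] cnt_min_Suc[of 0 M S ?x]
      cnt_min_Suc[of 0 N "- S" ?x] cnt_min_Suc[of N "2 * N" "- S" ?x] by auto
  have e: "aval (Load (Reg ''j'')) s' = int (label ?x)" using r 2(3) by simp
  show ?case
    unfolding runs_Seq runs_Assign e folds
  proof (rule runs_switch, goal_cases)
    case (4 t)
    define s1 where "s1 = set_reg s' ''e'' (int (label ?x))"
    define s2 where "s2 = set_reg s1 ''k'' (if int (label ?x) mod 3 = 0 then int k0
      else if int (label ?x) mod 3 = 1 then int k1 else int k2)"
    have s2: "set_reg s1 ''k'' (if reg s1 ''e'' mod 3 = 0 then aval (Reg ''k0'') s1
        else if reg s1 ''e'' mod 3 = 1 then aval (Reg ''k1'') s1 else aval (Reg ''k2'') s1) = s2"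
      unfolding s2_def by (simp add: s1_def r cong: if_cong split del: if_split)
    have b: "bval (Less (Div (Reg ''e'') (Const 3)) (Reg ''k'')) s2 \<longleftrightarrow> ?x \<in> S"
      unfolding K[symmetric] by (simp add: s2_def s1_def split del: if_split)
    have s2r: "reg s2 y = reg s' y" if "y \<notin> {''e'', ''k''}" for y using that by (simp add: s2_def s1_def)
    have s2m: "mem s2 = mem s" by (simp add: s2_def s1_def mem)
    have f2: "frame {''j'', ''e'', ''k'', ''a1'', ''a2'', ''b1'', ''b2''} s s2"
      using f by (simp add: frame_def s2r)
    have fr: "frame {''j'', ''e'', ''k'', ''a1'', ''a2'', ''b1'', ''b2''} s
        (s2\<lparr>reg := (reg s2)(y := v, ''j'' := v')\<rparr>)"
      if "y \<in> {''a1'', ''a2'', ''b1'', ''b2''}" for y v v'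
      using f2 that by (auto simp: frame_def)
    have fr0: "frame {''j'', ''e'', ''k'', ''a1'', ''a2'', ''b1'', ''b2''} s (set_reg s2 ''j'' v')" for v'
      using f2 by (simp add: frame_def)
    show ?case
      unfolding s1_def[symmetric] s2 runs_If b
      using 4 by (simp add: incr_com_def s2r s2m r 2(3) up fr fr0)
  qed simp_all
next
  case (3 k s')
  then show ?case using s by (simp add: frame_def ready_def)
next
  case (4 t s')
  then show ?case using N_gt M_gt by (simp add: cnt_compl)
qed

lemma (in torus_walk) runs_cycle:
  assumes s: "reg s ''a1'' = a1" "reg s ''a2'' = a2" "reg s ''b1'' = b1" "reg s ''b2'' = b2"
    "reg s ''p'' = 0" "reg s ''ok'' = 1" "reg s ''c'' = b2 + b1 + a2 + a1 - 1"
  shows "runs cycle_com s (\<lambda>t s'. t \<le> Q * 12 + 1 \<and> frame {''p'', ''ok'', ''j''} s s' \<and>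
    mem s' = mem s \<and> reg s' ''ok'' = (if single_cycle (walk S) V then 1 else 0))"
proof -
  interpret E: finite_perm E "{0..<b2 + b1 + a2 + a1}" by (rule E_perm)
  have "(0, 0) \<in> V" using n_gt m_gt by (simp add: cells_def)
  then have pos: "0 < b2 + b1 + a2 + a1" using line_range[of "(0, 0)"] by simp
  define K where "K = nat (b2 + b1 + a2 + a1 - 1)"
  have K: "b2 + b1 + a2 + a1 - 1 = int K" "card {0..<b2 + b1 + a2 + a1} = Suc K"
    using pos by (auto simp: K_def)
  have single: "single_cycle (walk S) V \<longleftrightarrow> \<not> (\<exists>j. 0 < j \<and> j \<le> K \<and> (E ^^ j) 0 = 0)"
    unfolding single_cycle_walk_iff using E.orb_eq_all_iff[of 0] pos K(2) by (auto simp: less_Suc_eq_le)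
  show ?thesis
    unfolding cycle_com_def
  proof (rule runs_For[where K = K and B = 10 and P = "\<lambda>k s'. frame {''p'', ''ok'', ''j''} s s' \<and>
      mem s' = mem s \<and> reg s' ''p'' = (E ^^ k) 0 \<and>
      reg s' ''ok'' = (if \<exists>j. 0 < j \<and> j \<le> k \<and> (E ^^ j) 0 = 0 then 0 else 1)"], goal_cases)
    case 1
    then show ?case using s by (simp add: frame_def)
  next
    case (2 k s')
    have r: "reg s' ''a1'' = a1" "reg s' ''a2'' = a2" "reg s' ''b1'' = b1" "reg s' ''b2'' = b2"
      using 2 s by (auto simp: frame_def)
    have E: "iet b2 b1 a2 a1 ((E ^^ k) 0) = (E ^^ Suc k) 0" by (simp add: E_def)
    have ex: "(\<exists>j. 0 < j \<and> j \<le> Suc k \<and> (E ^^ j) 0 = 0) \<longleftrightarrow>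
        (\<exists>j. 0 < j \<and> j \<le> k \<and> (E ^^ j) 0 = 0) \<or> (E ^^ Suc k) 0 = 0"
      by (auto simp: le_Suc_eq simp del: funpow.simps)
    have f: "frame {''p'', ''ok'', ''j''} s s'" and mem: "mem s' = mem s" and p: "reg s' ''p'' = (E ^^ k) 0"
      and ok: "reg s' ''ok'' = (if \<exists>j. 0 < j \<and> j \<le> k \<and> (E ^^ j) 0 = 0 then 0 else 1)"
      using 2(2) by auto
    show ?case
      unfolding runs_Seq
    proof (rule runs_iet, goal_cases)
      case (5 t)
      then show ?case
        unfolding r p E ex using f mem ok 2(3)
        by (cases "(E ^^ Suc k) 0 = 0") (simp_all add: frame_def del: funpow.simps)
    qed simp_all
  next
    case (3 k s')
    then show ?case using s K by (simp add: frame_def)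
  next
    case (4 t s')
    \<comment> \<open>The number of lines is at most \<open>2 * m + 2 * n\<close>, which keeps a
      single test linear.\<close>
    have "int K \<le> int Q" using sum_le K by simp
    then have "K * 12 + 1 \<le> Q * 12 + 1" by simp
    moreover have "reg s' ''ok'' = (if single_cycle (walk S) V then 1 else 0)"
    proof -
      have "reg s' ''ok'' = (if \<exists>j. 0 < j \<and> j \<le> K \<and> (E ^^ j) 0 = 0 then 0 else 1)" using 4(1) by blast
      also have "\<dots> = (if single_cycle (walk S) V then 1 else 0)" unfolding single by auto
      finally show ?thesis .
    qed
    ultimately show ?case using 4 by simp
  qed
qed

lemma (in torus) runs_test:
  assumes s: "ready s" "\<forall>x\<in>I. mem s x = int (label x)"
      "reg s ''k0'' = int k0" "reg s ''k1'' = int k1" "reg s ''k2'' = int k2"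
  shows "runs test_com s (\<lambda>t s'. t \<le> Q * 24 + 7 \<and>
    frame {''j'', ''e'', ''k'', ''a1'', ''a2'', ''b1'', ''b2'', ''c'', ''p'', ''ok'', ''result''} s s' \<and>
    mem s' = mem s \<and>
    reg s' ''result'' = (if single_cycle (walk (encoded k0 k1 k2)) V then 1 else reg s ''result''))"
proof -
  define S where "S = encoded k0 k1 k2"
  interpret torus_walk n m S
    using encoded_invariant by unfold_locales (simp add: S_def)
  show ?thesis
    unfolding test_com_def runs_Seq runs_Assign
  proof (rule runs_mono[OF runs_count[OF _ _ _ _ _ _ _ _ _ S_def]], goal_cases)
    case (10 t1 s1)
    note f1 = 10[THEN conjunct2, THEN conjunct1, unfolded frame_def]
    show ?case
    proof (rule runs_mono[OF runs_cycle], goal_cases)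
      case (8 t2 s2)
      note f2 = 8[THEN conjunct2, THEN conjunct1, unfolded frame_def]
      show ?case
        using 8 10 f1 f2 by (auto simp: S_def[symmetric] frame_def)
    qed (use 10 f1 in \<open>simp_all add: a1_def a2_def b1_def b2_def\<close>)
  qed (use s in \<open>simp_all add: ready_def\<close>)
qed

section \<open>Enumeration of the cases and total running time\<close>

context torus
begin

abbreviation W where "W \<equiv> 6 * gcd m n + 1"

definition option_set :: "nat \<Rightarrow> int set" where
  "option_set i = encoded (i mod W) (i div W mod W) (i div W div W)"

lemma hamiltonian_iff_option:
  "hamiltonian G \<longleftrightarrow> (\<exists>i < W * W * W. single_cycle (walk (option_set i)) V)"
proof
  assume "hamiltonian G"
  then obtain k0 k1 k2 where k: "k0 < W" "k1 < W" "k2 < W"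
    and c: "single_cycle (walk (encoded k0 k1 k2)) V"
    unfolding hamiltonian_iff_encoded by (auto simp: less_Suc_eq_le)
  have digit: "a < b \<Longrightarrow> (a + b * d) mod b = a \<and> (a + b * d) div b = d" for a b d :: nat by simp
  define i where "i = k0 + W * (k1 + W * k2)"
  have i1: "i mod W = k0" "i div W = k1 + W * k2"
    unfolding i_def using digit[OF k(1)] by blast+
  have i2: "i div W mod W = k1" "i div W div W = k2"
    unfolding i1(2) using digit[OF k(2)] by blast+
  have digit_less: "a + b * d < b * e" if "a < b" "d < e" for a b d e :: nat
  proof -
    have "b * (d + 1) \<le> b * e" using that(2) by (intro mult_le_mono2) simp
    then show ?thesis using that(1) by simp
  qed
  have "i < W * W * W"
    unfolding i_def mult.assoc by (intro digit_less k)
  with c show "\<exists>i < W * W * W. single_cycle (walk (option_set i)) V"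
    unfolding option_set_def using i1(1) i2 by metis
next
  assume "\<exists>i < W * W * W. single_cycle (walk (option_set i)) V"
  then show "hamiltonian G"
    unfolding option_set_def using walk_imp_hamiltonian encoded_invariant by blast
qed

lemma runs_search:
  assumes s: "ready s" "\<forall>x\<in>I. mem s x = int (label x)" "reg s ''w'' = int W"
      "reg s ''v'' = int (W * W * W)" "reg s ''result'' = 0"
  shows "runs search_com s (\<lambda>t s'. t \<le> W * W * W * (Q * 24 + 14) + 1 \<and>
    reg s' ''result'' = (if hamiltonian G then 1 else 0))"
  unfolding search_com_def
proof (rule runs_For[where K = "W * W * W" and B = "Q * 24 + 12" and P = "\<lambda>k s'. ready s' \<and>
    reg s' ''w'' = int W \<and> reg s' ''v'' = int (W * W * W) \<and> mem s' = mem s \<and>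
    reg s' ''result'' = (if \<exists>i<k. single_cycle (walk (option_set i)) V then 1 else 0)"], goal_cases)
  case 1
  then show ?case using s by (simp add: ready_def)
next
  case (2 k s')
  have a: "aval (Mod (Reg ''i'') (Reg ''w'')) s' = int (k mod W)"
    using 2 by (simp add: zmod_int)
  let ?s1 = "set_reg s' ''k0'' (int (k mod W))"
  have b: "aval (Mod (Div (Reg ''i'') (Reg ''w'')) (Reg ''w'')) ?s1 = int (k div W mod W)"
    using 2 by (simp add: zmod_int zdiv_int)
  let ?s2 = "set_reg ?s1 ''k1'' (int (k div W mod W))"
  have c: "aval (Div (Div (Reg ''i'') (Reg ''w'')) (Reg ''w'')) ?s2 = int (k div W div W)"
    using 2 by (simp add: zdiv_int)
  have ex: "(\<exists>i<Suc k. single_cycle (walk (option_set i)) V) \<longleftrightarrow>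
      (\<exists>i<k. single_cycle (walk (option_set i)) V) \<or> single_cycle (walk (option_set k)) V"
    by (auto simp: less_Suc_eq)
  note P = 2(2)[THEN conjunct1, unfolded ready_def] 2(2)[THEN conjunct2, THEN conjunct1]
    2(2)[THEN conjunct2, THEN conjunct2, THEN conjunct1]
    2(2)[THEN conjunct2, THEN conjunct2, THEN conjunct2, THEN conjunct1]
    2(2)[THEN conjunct2, THEN conjunct2, THEN conjunct2, THEN conjunct2]
  show ?case
    unfolding runs_Seq runs_Assign a b c
  proof (rule runs_mono[OF runs_test[of _ "k mod W" "k div W mod W" "k div W div W"]], goal_cases)
    case 1
    show ?case using P(1) by (simp add: ready_def)
  next
    case 2
    show ?case using P(4) s(2) by simp
  next
    case (6 t s'')
    note f = 6[THEN conjunct2, THEN conjunct1, unfolded frame_def]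
    show ?case
      unfolding ex using 6 f P 2(3)
      by (cases "single_cycle (walk (option_set k)) V") (simp_all add: option_set_def ready_def)
  qed simp_all
next
  case (3 k s')
  then show ?case by simp
next
  case (4 t s')
  have "reg s' ''result'' = (if hamiltonian G then 1 else 0)"
    unfolding hamiltonian_iff_option using 4(1) by blast
  then show ?case using 4(2) by (simp add: ac_simps)
qed

lemma runs_main:
  "runs main_com (input_state n m) (\<lambda>t s'. t \<le> 30000 * ((m + n) * gcd m n ^ 3) \<and>
    reg s' ''result'' = (if hamiltonian G then 1 else 0))"
  unfolding main_com_def runs_Seq runs_Assign
proof (rule runs_mono[OF runs_gcd], goal_cases)
  case 1
  then show ?case by (simp add: ready_def input_state_def)
next
  case 2
  then show ?case by (simp add: input_state_def)
next
  case (3 t1 s1)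
  let ?g = "gcd m n"
  let ?l = "set_reg s1 ''l'' (18 * int ?g)"
  let ?w = "set_reg ?l ''w'' (int W)"
  let ?v = "set_reg ?w ''v'' (int (W * W * W))"
  have e: "aval (Mul (Const 18) (Reg ''g'')) s1 = 18 * int ?g"
    "aval (Add (Mul (Const 6) (Reg ''g'')) (Const 1)) ?l = int W"
    "aval (Mul (Mul (Reg ''w'') (Reg ''w'')) (Reg ''w'')) ?w = int (W * W * W)"
    using 3 by (simp_all add: algebra_simps)
  have r: "ready ?v" "reg ?v ''l'' = 18 * int ?g" "reg ?v ''w'' = int W" 
    "reg ?v ''v'' = int (W * W * W)" "reg ?v ''result'' = 0"
    using 3 by (simp_all add: ready_def)
  show ?case
    unfolding e
  proof (rule runs_mono[OF runs_label[OF r(1,2)]], goal_cases)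
    case (1 t2 s2)
    note f = 1[THEN conjunct2, THEN conjunct1]
    have r2: "ready s2" "reg s2 ''w'' = int W" "reg s2 ''v'' = int (W * W * W)" "reg s2 ''result'' = 0"
      using frameD[OF f, of "''n''"] frameD[OF f, of "''m''"] frameD[OF f, of "''q''"]
        frameD[OF f, of "''w''"] frameD[OF f, of "''v''"] frameD[OF f, of "''result''"] r
      by (simp_all add: ready_def)
    show ?case
    proof (rule runs_mono[OF runs_search[OF r2(1) _ r2(2-4)]], goal_cases)
      case 1
      then show ?case using \<open>_ \<and> _ \<and> (\<forall>x\<in>I. mem s2 x = int (label x))\<close> by blast
    next
      case (2 t3 s3)
      define z where "z = (m + n) * ?g ^ 3"
      have g: "?g \<ge> 1" using m_gt by (simp add: Suc_le_eq)
      have g3: "?g \<le> ?g ^ 3" "1 \<le> ?g ^ 3" using g by (simp_all add: self_le_power)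
      have z1: "m + n \<le> z" using g3(2) by (simp add: z_def)
      have z2: "(m + n) * ?g \<le> z" "?g \<le> z" "?g ^ 3 \<le> z"
        unfolding z_def using g3 m_gt by (auto intro: mult_le_mono le_trans[OF g3(1)])
      \<comment> \<open>From \<open>6 * ?g + 1 \<le> 7 * ?g\<close>. Below, 16464 = 343 * 48, 4802 =
        343 * 14, 396 = 18 * 22 and 216 = 18 * 12; the total 21266 + 612 + 9 leaves room in 30000
        for the additive constants.\<close>
      have "W * W * W \<le> (7 * ?g) * (7 * ?g) * (7 * ?g)"
        using g by (intro mult_le_mono) auto
      then have W3: "W * W * W \<le> 343 * ?g ^ 3" by (simp add: power3_eq_cube)
      have "t3 \<le> W * W * W * (Q * 24 + 14) + 1" using 2 by blast
      also have "\<dots> \<le> 343 * ?g ^ 3 * (Q * 24 + 14) + 1" using W3 by (intro add_le_mono mult_le_mono1) auto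
      also have "\<dots> = 16464 * z + 4802 * ?g ^ 3 + 1" by (simp add: z_def algebra_simps)
      also have "\<dots> \<le> 21266 * z + 1" using z2 by simp
      finally have t3: "t3 \<le> 21266 * z + 1" .
      have "t2 \<le> 18 * ?g * (Q * 11 + 12) + 1" using 1 by blast
      also have "\<dots> = 396 * ((m + n) * ?g) + 216 * ?g + 1" by (simp add: algebra_simps)
      also have "\<dots> \<le> 612 * z + 1" using z2 by simp
      finally have t2: "t2 \<le> 612 * z + 1" .
      have "t1 \<le> 9 * z + 1" using 3 z1 by simp
      moreover have "z \<ge> 1" using z1 m_gt by simp
      ultimately show ?case
        using 2 t2 t3 by (simp add: z_def[symmetric])
    qed
  qed
qed

end

theorem mainTheorem1:
  shows "\<exists>(c :: com) (C :: nat). \<forall>(n :: nat) (m :: nat). n > 1 \<longrightarrow> m > 1 \<longrightarrow>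
           decides_within c n m (hamiltonian (torus_graph n m)) (C * ((m + n) * (gcd m n) ^ 3))"
proof (intro exI allI impI)
  fix n m :: nat
  assume "n > 1" "m > 1"
  then interpret torus n m by unfold_locales
  show "decides_within main_com n m (hamiltonian (torus_graph n m)) (30000 * ((m + n) * (gcd m n) ^ 3))"
    using runs_main unfolding runs_def decides_within_def by blast
qed

end
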